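(* Let $G$ be an essentially principal étale groupoid whose unit space is a Cantor set. Suppose that $G$ is purely infinite. Then the index map $I:[[G]]\to H_1(G)$ is surjective.
   Context: A Cantor set is a (non-empty) compact, metrizable, totally disconnected space with no isolated points. Clopen means closed and open. An étale groupoid is a second countable locally compact Hausdorff topological groupoid $G$ whose range map is a local homeomorphism. $G^{(0)}$ is the unit space, $s,r$ are the source and range maps, and $gh$ is defined when $s(g)=r(h)$. $G$ is essentially principal if the interior of $\{g\in G\mid r(g)=s(g)\}$ is $G^{(0)}$. A $G$-set is a subset $U\subset G$ such that $r|U$ and $s|U$ are injective; for an open $G$-set $U$, $\pi_U=r\circ(s|U)^{-1}:s(U)\to r(U)$ (a homeomorphism). When $G^{(0)}$ is compact, the topological full group $[[G]]$ is the group of all $\alpha\in\mathrm{Homeo}(G^{(0)})$ for which there is a compact open $G$-set $U$ with $\alpha=\pi_U$ (so $s(U)=r(U)=G^{(0)}$); when $G$ is essentially principal this $U$ is unique. A clopen set $A\subset G^{(0)}$ is properly infinite if there exist compact open $G$-sets $U,V\subset G$ such that $s(U)=s(V)=A$, $r(U)\cup r(V)\subset A$ and $r(U)\cap r(V)=\emptyset$. $G$ is purely infinite if every clopen set $A\subset G^{(0)}$ is properly infinite. Homology: $C_c(Y,\mathbb{Z})$ is the group of compactly supported continuous functions $Y\to\mathbb{Z}$. For a local homeomorphism $\pi:Y\to Z$, $\pi_*:C_c(Y,\mathbb{Z})\to C_c(Z,\mathbb{Z})$ is $\pi_*(f)(z)=\sum_{\pi(y)=z}f(y)$. Let $G^{(2)}$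 be the space of pairs $(g_1,g_2)$ with $s(g_1)=r(g_2)$, and $d_0(g_1,g_2)=g_2$, $d_1(g_1,g_2)=g_1g_2$, $d_2(g_1,g_2)=g_1$. Put $\delta_1=s_*-r_*:C_c(G,\mathbb{Z})\to C_c(G^{(0)},\mathbb{Z})$ and $\delta_2=d_{0*}-d_{1*}+d_{2*}:C_c(G^{(2)},\mathbb{Z})\to C_c(G,\mathbb{Z})$. Then $H_1(G)=\ker\delta_1/\mathrm{Im}\,\delta_2$. The index map is the homomorphism $I:[[G]]\to H_1(G)$, $I(\pi_U)=[1_U]$, where $1_U$ is the characteristic function of the compact open $G$-set $U$. *)

theory Defs
  imports "HOL-Analysis.Analysis" "HOL-Algebra.Coset" "HOL-Algebra.Bij"
begin

section \<open>Topological preliminaries\<close>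

definition cantor_space :: "'a topology \<Rightarrow> bool" where
  "cantor_space X \<longleftrightarrow>
     topspace X \<noteq> {} \<and> compact_space X \<and> metrizable_space X \<and>
     (\<forall>C. connectedin X C \<longrightarrow> (\<exists>x. C \<subseteq> {x})) \<and>
     (\<forall>x\<in>topspace X. \<not> openin X {x})"

definition local_homeomorphism :: "'a topology \<Rightarrow> 'b topology \<Rightarrow> ('a \<Rightarrow> 'b) \<Rightarrow> bool" where
  "local_homeomorphism Y Z p \<longleftrightarrow>
     (\<forall>y\<in>topspace Y. \<exists>U. openin Y U \<and> y \<in> U \<and> openin Z (p ` U) \<and>
        homeomorphic_map (subtopology Y U) (subtopology Z (p ` U)) p)"

definition clopenin :: "'a topology \<Rightarrow> 'a set \<Rightarrow> bool" where
  "clopenin X A \<longleftrightarrow> openin X A \<and> closedin X A"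


section \<open>Etale groupoids\<close>

text \<open>
  The groupoid is the set \<open>topspace (gtop G)\<close>; its topology is \<open>gtop G\<close>. The values of the
  structure maps outside this set, and of \<open>gmult\<close> on non-composable pairs, are irrelevant.
\<close>

record 'g groupoid =
  gtop :: "'g topology"
  gunits :: "'g set"
  src :: "'g \<Rightarrow> 'g"
  rng :: "'g \<Rightarrow> 'g"
  gmult :: "'g \<Rightarrow> 'g \<Rightarrow> 'g"
  ginv :: "'g \<Rightarrow> 'g"

definition arrows :: "('g, 'm) groupoid_scheme \<Rightarrow> 'g set" where
  "arrows G = topspace (gtop G)"

definition unit_space :: "('g, 'm) groupoid_scheme \<Rightarrow> 'g topology" where
  "unit_space G = subtopology (gtop G) (gunits G)"

definition composable :: "('g, 'm) groupoid_scheme \<Rightarrow> ('g \<times> 'g) set" where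
  "composable G = {(g, h). g \<in> arrows G \<and> h \<in> arrows G \<and> src G g = rng G h}"

definition composable_space :: "('g, 'm) groupoid_scheme \<Rightarrow> ('g \<times> 'g) topology" where
  "composable_space G = subtopology (prod_topology (gtop G) (gtop G)) (composable G)"

locale topological_groupoid =
  fixes G :: "('g, 'm) groupoid_scheme"
  assumes units_subset: "gunits G \<subseteq> arrows G"
    and src_in_units: "g \<in> arrows G \<Longrightarrow> src G g \<in> gunits G"
    and rng_in_units: "g \<in> arrows G \<Longrightarrow> rng G g \<in> gunits G"
    and src_unit: "u \<in> gunits G \<Longrightarrow> src G u = u"
    and rng_unit: "u \<in> gunits G \<Longrightarrow> rng G u = u"
    and mult_closed: "(g, h) \<in> composable G \<Longrightarrow> gmult G g h \<in> arrows G"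
    and src_mult: "(g, h) \<in> composable G \<Longrightarrow> src G (gmult G g h) = src G h"
    and rng_mult: "(g, h) \<in> composable G \<Longrightarrow> rng G (gmult G g h) = rng G g"
    and mult_assoc: "(g, h) \<in> composable G \<Longrightarrow> (h, k) \<in> composable G \<Longrightarrow>
        gmult G (gmult G g h) k = gmult G g (gmult G h k)"
    and rng_mult_left: "g \<in> arrows G \<Longrightarrow> gmult G (rng G g) g = g"
    and src_mult_right: "g \<in> arrows G \<Longrightarrow> gmult G g (src G g) = g"
    and inv_closed: "g \<in> arrows G \<Longrightarrow> ginv G g \<in> arrows G"
    and src_inv: "g \<in> arrows G \<Longrightarrow> src G (ginv G g) = rng G g"
    and rng_inv: "g \<in> arrows G \<Longrightarrow> rng G (ginv G g) = src G g"
    and mult_inv_right: "g \<in> arrows G \<Longrightarrow> gmult G g (ginv G g) = rng G g"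
    and mult_inv_left: "g \<in> arrows G \<Longrightarrow> gmult G (ginv G g) g = src G g"
    and continuous_mult:
      "continuous_map (composable_space G) (gtop G) (\<lambda>(g, h). gmult G g h)"
    and continuous_inv: "continuous_map (gtop G) (gtop G) (ginv G)"

locale etale_groupoid = topological_groupoid +
  assumes second_countable_gtop: "second_countable (gtop G)"
    and locally_compact_gtop: "locally_compact_space (gtop G)"
    and Hausdorff_gtop: "Hausdorff_space (gtop G)"
    and local_homeomorphism_rng: "local_homeomorphism (gtop G) (unit_space G) (rng G)"

definition essentially_principal :: "('g, 'm) groupoid_scheme \<Rightarrow> bool" where
  "essentially_principal G \<longleftrightarrow>
     gtop G interior_of {g \<in> arrows G. rng G g = src G g} = gunits G"

definition G_set :: "('g, 'm) groupoid_scheme \<Rightarrow> 'g set \<Rightarrow> bool" where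
  "G_set G U \<longleftrightarrow> U \<subseteq> arrows G \<and> inj_on (rng G) U \<and> inj_on (src G) U"

definition compact_open_G_set :: "('g, 'm) groupoid_scheme \<Rightarrow> 'g set \<Rightarrow> bool" where
  "compact_open_G_set G U \<longleftrightarrow> G_set G U \<and> compactin (gtop G) U \<and> openin (gtop G) U"

definition properly_infinite :: "('g, 'm) groupoid_scheme \<Rightarrow> 'g set \<Rightarrow> bool" where
  "properly_infinite G A \<longleftrightarrow>
     (\<exists>U V. compact_open_G_set G U \<and> compact_open_G_set G V \<and>
        src G ` U = A \<and> src G ` V = A \<and>
        rng G ` U \<union> rng G ` V \<subseteq> A \<and> rng G ` U \<inter> rng G ` V = {})"

definition purely_infinite :: "('g, 'm) groupoid_scheme \<Rightarrow> bool" where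
  "purely_infinite G \<longleftrightarrow> (\<forall>A. clopenin (unit_space G) A \<longrightarrow> properly_infinite G A)"


section \<open>The topological full group\<close>

definition G_set_map :: "('g, 'm) groupoid_scheme \<Rightarrow> 'g set \<Rightarrow> 'g \<Rightarrow> 'g" where
  "G_set_map G U = (\<lambda>x\<in>src G ` U. rng G (inv_into U (src G) x))"

text \<open>
  The domain and range conditions are part of the relation: \<open>G_set_map G U\<close> only records a
  function extended by \<open>undefined\<close> outside \<open>src G ` U\<close>.
\<close>

definition full_G_set_for :: "('g, 'm) groupoid_scheme \<Rightarrow> ('g \<Rightarrow> 'g) \<Rightarrow> 'g set \<Rightarrow> bool" where
  "full_G_set_for G \<alpha> U \<longleftrightarrow>
     compact_open_G_set G U \<and> src G ` U = gunits G \<and> rng G ` U = gunits G \<and>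
     \<alpha> = G_set_map G U"

definition full_group :: "('g, 'm) groupoid_scheme \<Rightarrow> ('g \<Rightarrow> 'g) monoid" where
  "full_group G = (BijGroup (gunits G))
     \<lparr>carrier := {\<alpha> \<in> extensional (gunits G).
        homeomorphic_map (unit_space G) (unit_space G) \<alpha> \<and> (\<exists>U. full_G_set_for G \<alpha> U)}\<rparr>"


section \<open>Homology and the index map\<close>

text \<open>
  Functions on the space are represented by their extension by zero to the whole type. In
  keeping with \<open>HOL-Algebra\<close>, the (additive) abelian groups below are written as monoid records.
\<close>

definition Cc :: "'y topology \<Rightarrow> ('y \<Rightarrow> int) monoid" where
  "Cc Y = \<lparr>carrier = {f. (\<forall>y. y \<notin> topspace Y \<longrightarrow> f y = 0) \<and>
              continuous_map Y (discrete_topology UNIV) f \<and>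
              compactin Y (Y closure_of {y \<in> topspace Y. f y \<noteq> 0})},
           monoid.mult = (\<lambda>f g y. f y + g y),
           one = (\<lambda>y. 0)\<rparr>"

text \<open>
  The fibre of \<open>p\<close> over \<open>z\<close> may be infinite, but for a local homeomorphism \<open>p\<close> only finitely many
  of its points lie in the support of a given \<open>f\<close>; the sum must be restricted to these
  because \<open>sum\<close> vanishes on infinite index sets.
\<close>

definition pushforward :: "'y topology \<Rightarrow> ('y \<Rightarrow> 'z) \<Rightarrow> ('y \<Rightarrow> int) \<Rightarrow> 'z \<Rightarrow> int" where
  "pushforward Y p f z = (\<Sum>y | y \<in> topspace Y \<and> p y = z \<and> f y \<noteq> 0. f y)"

definition d0 :: "'g \<times> 'g \<Rightarrow> 'g" where
  "d0 = (\<lambda>(g, h). h)"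

definition d1 :: "('g, 'm) groupoid_scheme \<Rightarrow> 'g \<times> 'g \<Rightarrow> 'g" where
  "d1 G = (\<lambda>(g, h). gmult G g h)"

definition d2 :: "'g \<times> 'g \<Rightarrow> 'g" where
  "d2 = (\<lambda>(g, h). g)"

definition \<delta>1 :: "('g, 'm) groupoid_scheme \<Rightarrow> ('g \<Rightarrow> int) \<Rightarrow> 'g \<Rightarrow> int" where
  "\<delta>1 G f = (\<lambda>u. pushforward (gtop G) (src G) f u - pushforward (gtop G) (rng G) f u)"

definition \<delta>2 :: "('g, 'm) groupoid_scheme \<Rightarrow> ('g \<times> 'g \<Rightarrow> int) \<Rightarrow> 'g \<Rightarrow> int" where
  "\<delta>2 G f = (\<lambda>g. pushforward (composable_space G) d0 f g
                 - pushforward (composable_space G) (d1 G) f g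
                 + pushforward (composable_space G) d2 f g)"

definition cycles1 :: "('g, 'm) groupoid_scheme \<Rightarrow> ('g \<Rightarrow> int) monoid" where
  "cycles1 G = (Cc (gtop G)) \<lparr>carrier := kernel (Cc (gtop G)) (Cc (unit_space G)) (\<delta>1 G)\<rparr>"

definition boundaries1 :: "('g, 'm) groupoid_scheme \<Rightarrow> ('g \<Rightarrow> int) set" where
  "boundaries1 G = \<delta>2 G ` carrier (Cc (composable_space G))"

definition H1 :: "('g, 'm) groupoid_scheme \<Rightarrow> ('g \<Rightarrow> int) set monoid" where
  "H1 G = cycles1 G Mod boundaries1 G"

definition homology_class1 :: "('g, 'm) groupoid_scheme \<Rightarrow> ('g \<Rightarrow> int) \<Rightarrow> ('g \<Rightarrow> int) set" where
  "homology_class1 G f = boundaries1 G #>\<^bsub>cycles1 G\<^esub> f"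

text \<open>
  The definite description is justified when \<open>G\<close> is essentially principal, as then the \<open>G\<close>-set
  representing a given element of the full group is unique.
\<close>

definition index_map :: "('g, 'm) groupoid_scheme \<Rightarrow> ('g \<Rightarrow> 'g) \<Rightarrow> ('g \<Rightarrow> int) set" where
  "index_map G \<alpha> = homology_class1 G (indicator (THE U. full_G_set_for G \<alpha> U))"

end

theory Submission
  imports Defs "HOL-Library.Function_Algebras"
begin

text \<open>
  For compact open \<open>G\<close>-sets with composable ends, the characteristic function of \<open>U V\<close> is homologous
  to the sum of those of \<open>U\<close> and \<open>V\<close>; hence clopen sets of units are null homologous and
  \<open>U\<^sup>-\<^sup>1\<close> represents minus \<open>U\<close>. As the unit space is zero-dimensional, every function is therefore
  homologous to a sum of characteristic functions of compact open \<open>G\<close>-sets \<open>U 0, \<dots>, U (n - 1)\<close>,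
  and for a cycle the sources and the ranges of these sets cover each unit equally often. Proper
  infiniteness of the unit space gives compact open \<open>G\<close>-sets \<open>W 0, W 1, \<dots>\<close> with full sources and
  disjoint ranges. Cut the \<open>U i\<close> into pieces \<open>P\<close> on which source and range have
  constant indices \<open>a\<close> and \<open>b\<close> in the multiple cover. The sets \<open>W b P (W a)\<^sup>-\<^sup>1\<close> have pairwise
  disjoint sources and ranges; their union has
  equal source and range, represents the given cycle, and is completed by units to a full \<open>G\<close>-set.
\<close>

section \<open>Integer-valued functions and their pushforwards\<close>

text \<open>The obstacle: the sets \<open>U i\<close> may overlap in source and in range, so their
  sum need not be the characteristic function of a \<open>G\<close>-set. The sets \<open>W n\<close>
  supply infinitely many disjoint copies of the unit space, enough room to store the overlapping
  layers separately. A piece \<open>P\<close> needs two copies, since the index of its source and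
  the index of its range belong to two unrelated covers; hence \<open>W b\<close> on the left and
  \<open>W a\<close> on the right. After this move the sources fill, in copy number
  \<open>n\<close>, exactly the points lying in more than \<open>n\<close> of the sources, and the
  ranges likewise those lying in more than \<open>n\<close> of the ranges. The cycle condition
  identifies these two sets. Their equality is used twice: it allows the completion by units, and it
  cancels the classes that multiplication by \<open>W b\<close> and by the inverse of
  \<open>W a\<close> introduces. Essential principality makes the full \<open>G\<close>-set of a
  homeomorphism unique, which gives the definite description in \<open>index_map\<close> its
  value.\<close>

lemma sum_fun_apply: "(\<Sum>i\<in>I. f i) x = (\<Sum>i\<in>I. f i x)"
  for f :: "'i \<Rightarrow> 'a \<Rightarrow> 'b :: comm_monoid_add"
  by (induction I rule: infinite_finite_induct) auto

lemma indicator_UN_disjoint_fun: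
  fixes F :: "'i \<Rightarrow> 'a set"
  assumes "finite I" "disjoint_family_on F I"
  shows "indicator (\<Union>i\<in>I. F i) = (\<Sum>i\<in>I. indicator (F i) :: 'a \<Rightarrow> int)"
  by (rule ext) (simp add: sum_fun_apply indicator_UN_disjoint assms)

lemma continuous_map_discrete_iff:
  "continuous_map X (discrete_topology UNIV) f \<longleftrightarrow> (\<forall>c. openin X {x \<in> topspace X. f x = c})"
proof
  assume f: "continuous_map X (discrete_topology UNIV) f"
  show "\<forall>c. openin X {x \<in> topspace X. f x = c}"
    using openin_continuous_map_preimage[OF f, of "{_}"] by simp
next
  assume *: "\<forall>c. openin X {x \<in> topspace X. f x = c}"
  have "openin X {x \<in> topspace X. f x \<in> U}" for U
  proof -
    have "{x \<in> topspace X. f x \<in> U} = (\<Union>c\<in>U. {x \<in> topspace X. f x = c})"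
      by auto
    then show ?thesis
      using * by auto
  qed
  then show "continuous_map X (discrete_topology UNIV) f"
    by (simp add: continuous_map_def)
qed

lemma continuous_map_discrete_binop:
  assumes "continuous_map X (discrete_topology UNIV) f"
    and "continuous_map X (discrete_topology UNIV) g"
  shows "continuous_map X (discrete_topology UNIV) (\<lambda>x. F (f x) (g x))"
  unfolding continuous_map_discrete_iff
proof
  fix c
  have "{x \<in> topspace X. F (f x) (g x) = c} =
      (\<Union>(a, b)\<in>{(a, b). F a b = c}. {x \<in> topspace X. f x = a} \<inter> {x \<in> topspace X. g x = b})"
    by auto
  also have "openin X \<dots>"
    using assms by (intro openin_Union) (auto simp: continuous_map_discrete_iff)
  finally show "openin X {x \<in> topspace X. F (f x) (g x) = c}" .
qed

lemma continuous_map_discrete_sum: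
  fixes f :: "'i \<Rightarrow> 'a \<Rightarrow> 'b :: comm_monoid_add"
  assumes "\<And>i. i \<in> I \<Longrightarrow> continuous_map X (discrete_topology UNIV) (f i)"
  shows "continuous_map X (discrete_topology UNIV) (\<lambda>x. \<Sum>i\<in>I. f i x)"
  using assms
  by (induction I rule: infinite_finite_induct) (auto intro!: continuous_map_discrete_binop[of _ _ _ "(+)"])

lemma clopenin_Int: "clopenin X A \<Longrightarrow> clopenin X B \<Longrightarrow> clopenin X (A \<inter> B)"
  by (auto simp: clopenin_def)

lemma clopenin_vimage:
  assumes "continuous_map X Y f" "clopenin Y A"
  shows "clopenin X {x \<in> topspace X. f x \<in> A}"
  using assms by (simp add: clopenin_def openin_continuous_map_preimage closedin_continuous_map_preimage)

lemma clopenin_eq: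
  assumes "continuous_map X (discrete_topology UNIV) f"
  shows "clopenin X {x \<in> topspace X. f x = c}"
  using clopenin_vimage[OF assms, of "{c}"] by (simp add: clopenin_def)

lemma continuous_map_indicator:
  assumes "clopenin X A"
  shows "continuous_map X (discrete_topology UNIV) (indicator A :: 'a \<Rightarrow> 'b :: zero_neq_one)"
  unfolding continuous_map_discrete_iff
proof
  fix c :: 'b
  have "A \<subseteq> topspace X" "openin X A" "openin X (topspace X - A)"
    using assms openin_subset by (auto simp: clopenin_def)
  moreover have "{x \<in> topspace X. indicator A x = c} =
      (if c = 1 then A else if c = 0 then topspace X - A else {})"
    using \<open>A \<subseteq> topspace X\<close> by (auto simp: indicator_def)
  ultimately show "openin X {x \<in> topspace X. indicator A x = c}"
    by simp
qed

section \<open>Compactly supported functions\<close>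

lemma carrier_Cc_iff:
  "f \<in> carrier (Cc Y) \<longleftrightarrow>
     continuous_map Y (discrete_topology UNIV) f \<and> compactin Y {y. f y \<noteq> 0}"
proof -
  \<comment> \<open>The set where \<open>f\<close> is nonzero is the preimage of a closed subset of
    a discrete space, so it is its own closure. Compactness in turn places it inside the topspace,
    which encodes the extension by zero.\<close>
  have *: "Y closure_of {y \<in> topspace Y. f y \<noteq> 0} = {y \<in> topspace Y. f y \<noteq> 0}"
    if "continuous_map Y (discrete_topology UNIV) f"
    using closedin_continuous_map_preimage[OF that, of "- {0}"] by (simp add: closure_of_eq)
  show ?thesis
  proof (cases "\<forall>y. y \<notin> topspace Y \<longrightarrow> f y = 0")
    case True
    then have "{y \<in> topspace Y. f y \<noteq> 0} = {y. f y \<noteq> 0}"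
      by auto
    with True * show ?thesis
      by (simp add: Cc_def) metis
  next
    case False
    then have "\<not> compactin Y {y. f y \<noteq> 0}"
      using compactin_subset_topspace by fastforce
    with False show ?thesis
      by (simp add: Cc_def)
  qed
qed

lemma Cc_binop:
  fixes f g :: "'a \<Rightarrow> int"
  assumes f: "f \<in> carrier (Cc Y)" and g: "g \<in> carrier (Cc Y)" and F: "F 0 0 = 0"
  shows "(\<lambda>y. F (f y) (g y)) \<in> carrier (Cc Y)"
proof -
  have cont: "continuous_map Y (discrete_topology UNIV) (\<lambda>y. F (f y) (g y))"
    using f g by (intro continuous_map_discrete_binop[of Y f g F]) (simp_all add: carrier_Cc_iff)
  have K: "compactin Y ({y. f y \<noteq> 0} \<union> {y. g y \<noteq> 0})"
    using f g by (intro compactin_Un) (simp_all add: carrier_Cc_iff)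
  have sub: "{y. F (f y) (g y) \<noteq> 0} \<subseteq> {y. f y \<noteq> 0} \<union> {y. g y \<noteq> 0}"
    using F by auto
  then have "{y. F (f y) (g y) \<noteq> 0} = {y \<in> topspace Y. F (f y) (g y) \<noteq> 0}"
    using compactin_subset_topspace[OF K] by auto
  then have "closedin Y {y. F (f y) (g y) \<noteq> 0}"
    using closedin_continuous_map_preimage[OF cont, of "- {0}"] by simp
  then show ?thesis
    using cont closed_compactin[OF K sub] by (simp add: carrier_Cc_iff)
qed

lemma Cc_zero: "0 \<in> carrier (Cc Y)"
  by (simp add: carrier_Cc_iff zero_fun_def)

lemma Cc_add: "f + g \<in> carrier (Cc Y)" if "f \<in> carrier (Cc Y)" "g \<in> carrier (Cc Y)"
  using Cc_binop[OF that, of "(+)"] by (simp add: plus_fun_def)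

lemma Cc_diff: "f - g \<in> carrier (Cc Y)" if "f \<in> carrier (Cc Y)" "g \<in> carrier (Cc Y)"
  using Cc_binop[OF that, of "(-)"] by (simp add: fun_diff_def)

lemma Cc_indicator:
  assumes "compactin Y A" "clopenin Y A"
  shows "indicator A \<in> carrier (Cc Y)"
proof -
  have "{y. (indicator A y :: int) \<noteq> 0} = A"
    by (auto simp: indicator_def)
  then show ?thesis
    using assms by (simp add: carrier_Cc_iff continuous_map_indicator)
qed

lemma Cc_sum:
  "(\<And>i. i \<in> I \<Longrightarrow> f i \<in> carrier (Cc Y)) \<Longrightarrow> (\<Sum>i\<in>I. f i) \<in> carrier (Cc Y)"
  by (induction I rule: infinite_finite_induct) (auto intro: Cc_zero Cc_add)

text \<open>The standing assumption under which the sum defining \<open>pushforward\<close> is meaningful.\<close>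

definition finite_fibres :: "'y topology \<Rightarrow> ('y \<Rightarrow> 'z) \<Rightarrow> ('y \<Rightarrow> int) \<Rightarrow> bool" where
  "finite_fibres Y p f \<longleftrightarrow> (\<forall>z. finite {y. y \<in> topspace Y \<and> p y = z \<and> f y \<noteq> 0})"

text \<open>The compact support is covered by finitely many open sets on which \<open>p\<close> is
  injective, and each of them meets a fibre in at most one point.\<close>

lemma finite_fibres_Cc:
  assumes f: "f \<in> carrier (Cc Y)"
    and p: "\<And>y. y \<in> topspace Y \<Longrightarrow> \<exists>U. openin Y U \<and> y \<in> U \<and> inj_on p U"
  shows "finite_fibres Y p f"
  unfolding finite_fibres_def
proof
  fix z
  let ?K = "{y. f y \<noteq> 0}"
  have K: "compactin Y ?K"
    using f by (simp add: carrier_Cc_iff)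
  define C' where "C' = {U. openin Y U \<and> inj_on p U}"
  have "?K \<subseteq> \<Union>C'" "\<forall>U\<in>C'. openin Y U"
    using p compactin_subset_topspace[OF K] by (fastforce simp: C'_def)+
  then obtain C where C: "finite C" "C \<subseteq> C'" "?K \<subseteq> \<Union>C"
    using K unfolding compactin_def by (metis (no_types, lifting))
  have "finite {y \<in> U. p y = z}" if "U \<in> C" for U
  proof -
    have "inj_on p U"
      using C(2) that by (auto simp: C'_def)
    then have "inj_on p {y \<in> U. p y = z}"
      by (rule inj_on_subset) auto
    moreover have "finite (p ` {y \<in> U. p y = z})"
      by (rule finite_subset[of _ "{z}"]) auto
    ultimately show ?thesis
      by (rule finite_imageD[rotated])
  qed
  then have "finite (\<Union>U\<in>C. {y \<in> U. p y = z})"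
    using C(1) by auto
  then show "finite {y. y \<in> topspace Y \<and> p y = z \<and> f y \<noteq> 0}"
    by (rule rev_finite_subset) (use C(3) in auto)
qed

text \<open>A fibre of \<open>q\<close> lies in a fibre of the composite. Finiteness for the face
  maps is obtained in this way from their composites with \<open>src\<close>.\<close>

lemma finite_fibres_comp: "finite_fibres Y (\<lambda>y. p (q y)) f \<Longrightarrow> finite_fibres Y q f"
  unfolding finite_fibres_def
proof
  fix z
  assume "\<forall>w. finite {y. y \<in> topspace Y \<and> p (q y) = w \<and> f y \<noteq> 0}"
  then have "finite {y. y \<in> topspace Y \<and> p (q y) = p z \<and> f y \<noteq> 0}"
    by blast
  then show "finite {y. y \<in> topspace Y \<and> q y = z \<and> f y \<noteq> 0}"
    by (rule rev_finite_subset) auto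
qed

lemma finite_fibres_cong:
  assumes "\<And>y. y \<in> topspace Y \<Longrightarrow> p y = q y"
  shows "finite_fibres Y p f \<longleftrightarrow> finite_fibres Y q f"
    and "pushforward Y p f = pushforward Y q f"
proof -
  have "{y. y \<in> topspace Y \<and> p y = z \<and> f y \<noteq> 0} = {y. y \<in> topspace Y \<and> q y = z \<and> f y \<noteq> 0}" for z
    using assms by auto
  then show "finite_fibres Y p f \<longleftrightarrow> finite_fibres Y q f" "pushforward Y p f = pushforward Y q f"
    by (simp_all add: finite_fibres_def pushforward_def fun_eq_iff)
qed

section \<open>Additivity and functoriality of pushforwards\<close>

lemma pushforward_superset:
  assumes "finite S" "{y. y \<in> topspace Y \<and> p y = z \<and> f y \<noteq> 0} \<subseteq> S"
    "S \<subseteq> {y \<in> topspace Y. p y = z}"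
  shows "pushforward Y p f z = sum f S"
  unfolding pushforward_def using assms by (intro sum.mono_neutral_left) auto

lemma pushforward_diff:
  assumes "finite_fibres Y p f" "finite_fibres Y p g"
  shows "pushforward Y p (f - g) = pushforward Y p f - pushforward Y p g"
proof
  fix z
  \<comment> \<open>With the union of both supports in the fibre as index set, all three sums run
    over one finite set.\<close>
  let ?S = "{y. y \<in> topspace Y \<and> p y = z \<and> f y \<noteq> 0} \<union> {y. y \<in> topspace Y \<and> p y = z \<and> g y \<noteq> 0}"
  have S: "finite ?S" "?S \<subseteq> {y \<in> topspace Y. p y = z}"
    using assms by (auto simp: finite_fibres_def)
  have "pushforward Y p h z = sum h ?S" if "\<And>y. f y = 0 \<Longrightarrow> g y = 0 \<Longrightarrow> h y = 0" for h
    using that S by (intro pushforward_superset) auto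
  then show "pushforward Y p (f - g) z = (pushforward Y p f - pushforward Y p g) z"
    by (simp add: sum_subtractf)
qed

lemma pushforward_zero [simp]: "pushforward Y p 0 = 0"
  by (auto simp: pushforward_def)

lemma finite_fibres_diff:
  assumes "finite_fibres Y p f" "finite_fibres Y p g"
  shows "finite_fibres Y p (f - g)"
  unfolding finite_fibres_def
proof
  fix z
  have "finite ({y. y \<in> topspace Y \<and> p y = z \<and> f y \<noteq> 0} \<union> {y. y \<in> topspace Y \<and> p y = z \<and> g y \<noteq> 0})"
    using assms by (simp add: finite_fibres_def)
  then show "finite {y. y \<in> topspace Y \<and> p y = z \<and> (f - g) y \<noteq> 0}"
    by (rule rev_finite_subset) auto
qed

lemma finite_fibres_zero: "finite_fibres Y p 0"
  by (simp add: finite_fibres_def)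

lemma pushforward_add:
  assumes "finite_fibres Y p f" "finite_fibres Y p g"
  shows "pushforward Y p (f + g) = pushforward Y p f + pushforward Y p g"
proof -
  have g: "finite_fibres Y p (0 - g)"
    by (intro finite_fibres_diff finite_fibres_zero assms)
  have "pushforward Y p (f - (0 - g)) = pushforward Y p f - (pushforward Y p 0 - pushforward Y p g)"
    by (simp only: pushforward_diff[OF assms(1) g] pushforward_diff[OF finite_fibres_zero assms(2)])
  then show ?thesis by simp
qed

lemma pushforward_indicator:
  assumes "S \<subseteq> topspace Y" "inj_on p S"
  shows "pushforward Y p (indicator S) = indicator (p ` S)"
proof
  fix z
  show "pushforward Y p (indicator S) z = indicator (p ` S) z"
  proof (cases "z \<in> p ` S")
    case True
    then obtain y where y: "y \<in> S" "z = p y"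
      by auto
    have "pushforward Y p (indicator S) z = sum (indicator S) {y}"
      using assms y by (intro pushforward_superset) (auto simp: indicator_def dest: inj_onD)
    then show ?thesis
      using y by simp
  next
    case False
    have "pushforward Y p (indicator S) z = sum (indicator S) {}"
      using False by (intro pushforward_superset) (auto simp: indicator_def)
    then show ?thesis
      using False by simp
  qed
qed

text \<open>Functoriality: the sum over a fibre of the composite is regrouped by the values of
  \<open>q\<close>. Finiteness for the composite also controls the fibres of \<open>p\<close>,
  because the pushed function vanishes off the image of the support.\<close>

lemma
  assumes fin: "finite_fibres Y (\<lambda>y. p (q y)) f" and q: "q ` topspace Y \<subseteq> topspace Z"
  shows finite_fibres_pushforward: "finite_fibres Z p (pushforward Y q f)"
    and pushforward_comp: "pushforward Z p (pushforward Y q f) = pushforward Y (\<lambda>y. p (q y)) f"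
proof -
  define S where "S w = {y. y \<in> topspace Y \<and> p (q y) = w \<and> f y \<noteq> 0}" for w
  have S: "finite (S w)" for w
    using fin by (simp add: finite_fibres_def S_def)
  have zero: "pushforward Y q f z = 0" if "z \<notin> q ` S (p z)" for z
  proof -
    have "{y. y \<in> topspace Y \<and> q y = z \<and> f y \<noteq> 0} = {}"
      using that by (auto simp: S_def)
    then show ?thesis
      by (simp only: pushforward_def sum.empty)
  qed
  have sub: "{z. z \<in> topspace Z \<and> p z = w \<and> pushforward Y q f z \<noteq> 0} \<subseteq> q ` S w" for w
    using zero by blast
  show "finite_fibres Z p (pushforward Y q f)"
    unfolding finite_fibres_def using finite_subset[OF sub finite_imageI[OF S]] by blast
  show "pushforward Z p (pushforward Y q f) = pushforward Y (\<lambda>y. p (q y)) f"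
  proof
    fix w
    have "pushforward Z p (pushforward Y q f) w = (\<Sum>z\<in>q ` S w. pushforward Y q f z)"
      using S sub q by (intro pushforward_superset) (auto simp: S_def)
    also have "\<dots> = (\<Sum>z\<in>q ` S w. \<Sum>y | y \<in> S w \<and> q y = z. f y)"
      unfolding pushforward_def by (intro sum.cong) (auto simp: S_def)
    also have "\<dots> = sum f (S w)"
      using sum.image_gen[OF S, of f w q] by simp
    finally show "pushforward Z p (pushforward Y q f) w = pushforward Y (\<lambda>y. p (q y)) f w"
      by (simp add: pushforward_def S_def)
  qed
qed

text \<open>In a compact Hausdorff space a point and a closed set are separated by clopen sets
  unless a connected set meets both. Here connected sets have at most one point, and
  \<open>x\<close> lies in \<open>W\<close>.\<close>

lemma zero_dimensional_nhds:
  assumes X: "compact_space X" "Hausdorff_space X"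
    and disc: "\<And>C. connectedin X C \<Longrightarrow> \<exists>x. C \<subseteq> {x}"
    and W: "openin X W" "x \<in> W"
  obtains A where "clopenin X A" "x \<in> A" "A \<subseteq> W"
proof -
  have x: "x \<in> topspace X"
    using W openin_subset by blast
  have "separated_between X {x} (topspace X - W)"
  proof (rule cut_wire_fence_theorem[OF X])
    show "closedin X {x}"
      using X x by (simp add: closedin_Hausdorff_singleton)
    show "disjnt C {x} \<or> disjnt C (topspace X - W)" if "connectedin X C" for C
      using disc[OF that] W by (auto simp: disjnt_iff)
  qed (use W in blast)
  then obtain U V where UV: "openin X U" "openin X V" "U \<union> V = topspace X" "disjnt U V"
      "x \<in> U" "topspace X - W \<subseteq> V"
    unfolding separated_between_def by blast
  have "topspace X - U = V" "U \<subseteq> topspace X" "U \<subseteq> W"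
    using UV(3,4,6) by (auto simp: disjnt_iff)
  then show ?thesis
    using that[of U] UV by (simp add: clopenin_def closedin_def)
qed

section \<open>Compact open G-sets\<close>

context topological_groupoid
begin

lemmas structure_simps =
  src_in_units rng_in_units src_unit rng_unit src_mult rng_mult rng_mult_left src_mult_right
  inv_closed src_inv rng_inv mult_inv_right mult_inv_left mult_closed

lemma composable_iff: "(g, h) \<in> composable G \<longleftrightarrow> g \<in> arrows G \<and> h \<in> arrows G \<and> src G g = rng G h"
  by (simp add: composable_def)

lemma units_arrows: "u \<in> gunits G \<Longrightarrow> u \<in> arrows G"
  using units_subset by auto

lemma inv_mult_cancel_left:
  assumes "(g, h) \<in> composable G"
  shows "gmult G (ginv G g) (gmult G g h) = h"
proof -
  have "gmult G (ginv G g) (gmult G g h) = gmult G (gmult G (ginv G g) g) h"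
    using assms by (intro mult_assoc[symmetric]) (auto simp: composable_iff structure_simps)
  then show ?thesis
    using assms by (auto simp: composable_iff structure_simps)
qed

lemma inv_mult_cancel_right:
  assumes "(g, h) \<in> composable G"
  shows "gmult G (gmult G g h) (ginv G h) = g"
proof -
  have "gmult G (gmult G g h) (ginv G h) = gmult G g (gmult G h (ginv G h))"
    using assms by (intro mult_assoc) (auto simp: composable_iff structure_simps)
  then show ?thesis
    using assms by (auto simp: composable_iff structure_simps) (metis src_mult_right)
qed

lemma inv_inv: "g \<in> arrows G \<Longrightarrow> ginv G (ginv G g) = g"
  using inv_mult_cancel_left[of "ginv G g" g] src_mult_right[of "ginv G (ginv G g)"]
  by (simp add: composable_iff structure_simps)

lemma mult_inv_cancel_left:
  assumes "g \<in> arrows G" "k \<in> arrows G" "rng G g = rng G k"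
  shows "gmult G g (gmult G (ginv G g) k) = k"
  using inv_mult_cancel_left[of "ginv G g" k] assms
  by (simp add: composable_iff structure_simps inv_inv)

text \<open>A unit equals its own source, which here is \<open>rng G h\<close>; multiplying on the
  right by \<open>h\<close> gives \<open>g\<close> on one side and \<open>h\<close> on the
  other.\<close>

lemma mult_inv_unit_imp_eq:
  assumes "g \<in> arrows G" "h \<in> arrows G" "src G g = src G h" "gmult G g (ginv G h) \<in> gunits G"
  shows "g = h"
proof -
  have c: "(g, ginv G h) \<in> composable G"
    using assms by (simp add: composable_iff structure_simps)
  have "gmult G g (ginv G h) = rng G (ginv G (ginv G h))"
    using assms(4) src_mult[OF c] assms(2) by (simp add: structure_simps src_unit inv_inv)
  moreover have "gmult G (gmult G g (ginv G h)) (ginv G (ginv G h)) = g"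
    by (rule inv_mult_cancel_right[OF c])
  ultimately show ?thesis
    using assms rng_mult_left[of h] by (simp add: inv_inv)
qed

lemma image_src_inv: "U \<subseteq> arrows G \<Longrightarrow> src G ` ginv G ` U = rng G ` U"
  by (force simp: image_image src_inv subset_iff)

lemma image_rng_inv: "U \<subseteq> arrows G \<Longrightarrow> rng G ` ginv G ` U = src G ` U"
  by (force simp: image_image rng_inv subset_iff)

end

section \<open>Topology of the range and source maps\<close>

context etale_groupoid
begin

lemma topspace_gtop: "topspace (gtop G) = arrows G"
  by (simp add: arrows_def)

lemma topspace_unit_space: "topspace (unit_space G) = gunits G"
  using units_subset by (auto simp: unit_space_def topspace_gtop)

lemma Hausdorff_unit_space: "Hausdorff_space (unit_space G)"
  by (simp add: unit_space_def Hausdorff_space_subtopology Hausdorff_gtop)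

lemma rng_chart:
  assumes "g \<in> arrows G"
  obtains U where "openin (gtop G) U" "g \<in> U" "openin (unit_space G) (rng G ` U)"
    "homeomorphic_map (subtopology (gtop G) U) (subtopology (unit_space G) (rng G ` U)) (rng G)"
  using local_homeomorphism_rng assms by (auto simp: local_homeomorphism_def topspace_gtop)

lemma rng_nhd:
  assumes "g \<in> arrows G"
  obtains U where "openin (gtop G) U" "g \<in> U" "inj_on (rng G) U"
proof -
  obtain U where U: "openin (gtop G) U" "g \<in> U"
    "homeomorphic_map (subtopology (gtop G) U) (subtopology (unit_space G) (rng G ` U)) (rng G)"
    using rng_chart[OF assms] by metis
  have "topspace (subtopology (gtop G) U) = U"
    using openin_subset[OF U(1)] by auto
  then show ?thesis
    using that[OF U(1,2)] homeomorphic_imp_injective_map[OF U(3)] by simp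
qed

lemma continuous_rng: "continuous_map (gtop G) (unit_space G) (rng G)"
  unfolding continuous_map_def
proof (intro conjI allI impI)
  show "rng G \<in> topspace (gtop G) \<rightarrow> topspace (unit_space G)"
    by (simp add: topspace_gtop topspace_unit_space rng_in_units)
  fix W assume W: "openin (unit_space G) W"
  show "openin (gtop G) {g \<in> topspace (gtop G). rng G g \<in> W}"
  proof (subst openin_subopen, clarify)
    fix g assume g: "g \<in> topspace (gtop G)" "rng G g \<in> W"
    then obtain U where U: "openin (gtop G) U" "g \<in> U"
      "homeomorphic_map (subtopology (gtop G) U) (subtopology (unit_space G) (rng G ` U)) (rng G)"
      using rng_chart topspace_gtop by metis
    have "continuous_map (subtopology (gtop G) U) (unit_space G) (rng G)"
      using homeomorphic_imp_continuous_map[OF U(3)] by (rule continuous_map_into_fulltopology)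
    then have "openin (subtopology (gtop G) U) {x \<in> topspace (subtopology (gtop G) U). rng G x \<in> W}"
      using W by (rule openin_continuous_map_preimage)
    then have "openin (gtop G) {x \<in> topspace (subtopology (gtop G) U). rng G x \<in> W}"
      using U(1) openin_trans_full by blast
    then show "\<exists>T. openin (gtop G) T \<and> g \<in> T \<and> T \<subseteq> {g \<in> topspace (gtop G). rng G g \<in> W}"
      using g U(2) by (intro exI[of _ "{x \<in> topspace (subtopology (gtop G) U). rng G x \<in> W}"]) auto
  qed
qed

lemma continuous_rng_gtop: "continuous_map (gtop G) (gtop G) (rng G)"
  using continuous_rng unfolding unit_space_def by (rule continuous_map_into_fulltopology)

lemma open_map_rng: "open_map (gtop G) (unit_space G) (rng G)"
  unfolding open_map_def
proof (intro allI impI)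
  fix W assume W: "openin (gtop G) W"
  show "openin (unit_space G) (rng G ` W)"
  proof (subst openin_subopen, clarify)
    fix g assume g: "g \<in> W"
    then have "g \<in> arrows G"
      using openin_subset[OF W] topspace_gtop by auto
    then obtain U where U: "openin (gtop G) U" "g \<in> U" "openin (unit_space G) (rng G ` U)"
      "homeomorphic_map (subtopology (gtop G) U) (subtopology (unit_space G) (rng G ` U)) (rng G)"
      by (rule rng_chart)
    have "openin (subtopology (gtop G) U) (W \<inter> U)"
      using W by (simp add: openin_subtopology_Int)
    then have "openin (subtopology (unit_space G) (rng G ` U)) (rng G ` (W \<inter> U))"
      using homeomorphic_imp_open_map[OF U(4)] by (simp add: open_map_def)
    then have "openin (unit_space G) (rng G ` (W \<inter> U))"
      using U(3) openin_trans_full by blast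
    then show "\<exists>T. openin (unit_space G) T \<and> rng G g \<in> T \<and> T \<subseteq> rng G ` W"
      using g U(2) by blast
  qed
qed

text \<open>Let \<open>rng\<close> be injective on an open \<open>U\<close> around a unit. If
  \<open>g\<close> and \<open>rng G g\<close> both lie in \<open>U\<close>, they have the same
  range, so \<open>g\<close> is the unit \<open>rng G g\<close>.\<close>

lemma openin_units: "openin (gtop G) (gunits G)"
proof (subst openin_subopen, clarify)
  fix u assume u: "u \<in> gunits G"
  then obtain U where U: "openin (gtop G) U" "u \<in> U" "inj_on (rng G) U"
    using rng_nhd units_arrows by metis
  let ?V = "{g \<in> U. rng G g \<in> U}"
  have "g \<in> gunits G" if g: "g \<in> ?V" for g
  proof -
    have "g \<in> arrows G"
      using g openin_subset[OF U(1)] topspace_gtop by auto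
    then have "rng G (rng G g) = rng G g" "rng G g \<in> gunits G"
      by (simp_all add: structure_simps)
    then show ?thesis
      using g U(3) by (metis (no_types, lifting) inj_onD mem_Collect_eq)
  qed
  moreover have "openin (gtop G) ?V"
    by (rule openin_continuous_map_preimage_gen[OF continuous_rng_gtop U(1) U(1)])
  moreover have "u \<in> ?V"
    using U u by (simp add: rng_unit)
  ultimately show "\<exists>T. openin (gtop G) T \<and> u \<in> T \<and> T \<subseteq> gunits G"
    by blast
qed

lemma openin_unit_space_iff: "openin (unit_space G) W \<longleftrightarrow> openin (gtop G) W \<and> W \<subseteq> gunits G"
  unfolding unit_space_def using openin_units by (simp add: openin_open_subtopology)

lemma continuous_src: "continuous_map (gtop G) (unit_space G) (src G)"
proof -
  have "continuous_map (gtop G) (unit_space G) (rng G \<circ> ginv G)"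
    by (rule continuous_map_compose[OF continuous_inv continuous_rng])
  then show ?thesis
    by (rule continuous_map_eq) (simp add: topspace_gtop rng_inv)
qed

lemma continuous_src_gtop: "continuous_map (gtop G) (gtop G) (src G)"
  using continuous_src unfolding unit_space_def by (rule continuous_map_into_fulltopology)

lemma ginv_image_eq: "U \<subseteq> arrows G \<Longrightarrow> ginv G ` U = {g \<in> topspace (gtop G). ginv G g \<in> U}"
  by (force simp: topspace_gtop inv_inv inv_closed subset_iff image_iff)

lemma openin_inv_image: "openin (gtop G) U \<Longrightarrow> openin (gtop G) (ginv G ` U)"
  using ginv_image_eq[of U] openin_subset[of "gtop G" U] topspace_gtop
    openin_continuous_map_preimage[OF continuous_inv] by auto

lemma inj_on_src_inv_image:
  assumes "U \<subseteq> arrows G" "inj_on (rng G) U"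
  shows "inj_on (src G) (ginv G ` U)"
  using assms by (auto simp: inj_on_def src_inv subset_iff) 

lemma inj_on_rng_inv_image:
  assumes "U \<subseteq> arrows G" "inj_on (src G) U"
  shows "inj_on (rng G) (ginv G ` U)"
  using assms by (auto simp: inj_on_def rng_inv subset_iff) 

lemma src_nhd:
  assumes "g \<in> arrows G"
  obtains U where "openin (gtop G) U" "g \<in> U" "inj_on (src G) U"
proof -
  obtain U where U: "openin (gtop G) U" "ginv G g \<in> U" "inj_on (rng G) U"
    using rng_nhd[of "ginv G g"] assms inv_closed by metis
  have "U \<subseteq> arrows G"
    using openin_subset[OF U(1)] topspace_gtop by simp
  moreover have "g \<in> ginv G ` U"
    using U(2) inv_inv[OF assms] by force
  ultimately show ?thesis
    using that[of "ginv G ` U"] U openin_inv_image inj_on_src_inv_image by blast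
qed

lemma G_set_nhd:
  assumes "g \<in> arrows G"
  obtains U where "openin (gtop G) U" "g \<in> U" "G_set G U"
proof -
  obtain U where U: "openin (gtop G) U" "g \<in> U" "inj_on (rng G) U"
    using rng_nhd[OF assms] by metis
  obtain V where V: "openin (gtop G) V" "g \<in> V" "inj_on (src G) V"
    using src_nhd[OF assms] by metis
  have "openin (gtop G) (U \<inter> V)"
    using U V by blast
  moreover from this have "G_set G (U \<inter> V)"
    using U(3) V(3) openin_subset topspace_gtop
    unfolding G_set_def by (metis inf_le1 inf_le2 inj_on_subset)
  ultimately show ?thesis
    using that U V by blast
qed

section \<open>Closure properties of compact open G-sets\<close>

lemma compact_open_G_setD:
  assumes "compact_open_G_set G U"
  shows "U \<subseteq> arrows G" "inj_on (rng G) U" "inj_on (src G) U"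
    "compactin (gtop G) U" "openin (gtop G) U" "clopenin (gtop G) U"
  using assms compactin_imp_closedin[OF Hausdorff_gtop]
  by (auto simp: compact_open_G_set_def G_set_def clopenin_def)

lemma compact_open_G_set_subset:
  assumes "compact_open_G_set G U" "V \<subseteq> U" "clopenin (gtop G) V"
  shows "compact_open_G_set G V"
proof -
  have "compactin (gtop G) V"
    using assms closed_compactin by (auto simp: compact_open_G_set_def clopenin_def)
  moreover have "G_set G V"
    using assms by (auto simp: compact_open_G_set_def G_set_def inj_on_subset)
  ultimately show ?thesis
    using assms by (simp add: compact_open_G_set_def clopenin_def)
qed

lemma compact_open_G_set_restrict:
  assumes "compact_open_G_set G U" "clopenin (gtop G) {g \<in> topspace (gtop G). P g}"
  shows "compact_open_G_set G {g \<in> U. P g}"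
proof (rule compact_open_G_set_subset[OF assms(1)])
  have "{g \<in> U. P g} = U \<inter> {g \<in> topspace (gtop G). P g}"
    using compact_open_G_setD(1)[OF assms(1)] topspace_gtop by auto
  then show "clopenin (gtop G) {g \<in> U. P g}"
    using clopenin_Int[OF compact_open_G_setD(6)[OF assms(1)] assms(2)] by simp
qed auto

lemma compact_open_G_set_inv:
  assumes "compact_open_G_set G U"
  shows "compact_open_G_set G (ginv G ` U)"
proof -
  note U = compact_open_G_setD[OF assms]
  have "ginv G ` U \<subseteq> arrows G"
    using U(1) inv_closed by auto
  then show ?thesis
    unfolding compact_open_G_set_def G_set_def
    using U inj_on_rng_inv_image inj_on_src_inv_image openin_inv_image
      image_compactin[OF U(4) continuous_inv] by simp
qed

text \<open>\<open>rng\<close> is an open map, and the compact image is closed in the Hausdorff unit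
  space.\<close>

lemma clopenin_rng_image:
  assumes "compact_open_G_set G U"
  shows "clopenin (unit_space G) (rng G ` U)"
proof -
  note U = compact_open_G_setD[OF assms]
  have "compactin (unit_space G) (rng G ` U)"
    by (rule image_compactin[OF U(4) continuous_rng])
  then show ?thesis
    using compactin_imp_closedin[OF Hausdorff_unit_space] open_map_rng U(5)
    by (simp add: clopenin_def open_map_def)
qed

lemma clopenin_src_image:
  assumes "compact_open_G_set G U"
  shows "clopenin (unit_space G) (src G ` U)"
  using clopenin_rng_image[OF compact_open_G_set_inv[OF assms]] compact_open_G_setD(1)[OF assms]
  by (simp add: image_rng_inv)

lemma compact_open_G_set_src_restrict:
  assumes "compact_open_G_set G U" "clopenin (unit_space G) A"
  shows "compact_open_G_set G {g \<in> U. src G g \<in> A}"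
  by (rule compact_open_G_set_restrict[OF assms(1) clopenin_vimage[OF continuous_src assms(2)]])

lemma compact_open_G_set_units:
  assumes "compact_space (unit_space G)" "clopenin (unit_space G) A"
  shows "compact_open_G_set G A"
proof -
  have A: "openin (gtop G) A" "A \<subseteq> gunits G"
    using assms(2) by (auto simp: clopenin_def openin_unit_space_iff)
  have "compactin (unit_space G) A"
    using assms closedin_compact_space by (auto simp: clopenin_def)
  then have "compactin (gtop G) A"
    by (simp add: unit_space_def compactin_subtopology)
  moreover have "inj_on (rng G) A" "inj_on (src G) A"
    using A(2) by (auto intro!: inj_onI simp: rng_unit src_unit subset_iff)
  ultimately show ?thesis
    using A units_arrows by (auto simp: compact_open_G_set_def G_set_def)
qed

lemma compact_open_G_set_UN:
  assumes "finite I" "\<And>i. i \<in> I \<Longrightarrow> compact_open_G_set G (U i)"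
    and src: "\<And>i j. i \<in> I \<Longrightarrow> j \<in> I \<Longrightarrow> i \<noteq> j \<Longrightarrow> src G ` U i \<inter> src G ` U j = {}"
    and rng: "\<And>i j. i \<in> I \<Longrightarrow> j \<in> I \<Longrightarrow> i \<noteq> j \<Longrightarrow> rng G ` U i \<inter> rng G ` U j = {}"
  shows "compact_open_G_set G (\<Union>i\<in>I. U i)"
proof -
  have *: "inj_on f (\<Union>i\<in>I. U i)"
    if "\<And>i. i \<in> I \<Longrightarrow> inj_on f (U i)"
      "\<And>i j. i \<in> I \<Longrightarrow> j \<in> I \<Longrightarrow> i \<noteq> j \<Longrightarrow> f ` U i \<inter> f ` U j = {}" for f :: "'a \<Rightarrow> 'a"
  proof (rule inj_onI)
    fix x y assume "x \<in> (\<Union>i\<in>I. U i)" "y \<in> (\<Union>i\<in>I. U i)" and eq: "f x = f y"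
    then obtain i j where ij: "i \<in> I" "x \<in> U i" "j \<in> I" "y \<in> U j"
      by auto
    have "i = j"
      using that(2)[OF ij(1,3)] ij eq by (metis IntI empty_iff imageI)
    then show "x = y"
      using that(1)[OF ij(1)] ij eq by (auto dest: inj_onD)
  qed
  show ?thesis
    unfolding compact_open_G_set_def G_set_def
  proof (intro conjI)
    show "compactin (gtop G) (\<Union>i\<in>I. U i)"
      using assms(1,2) compact_open_G_setD(4) by (intro compactin_Union) auto
    show "inj_on (rng G) (\<Union>i\<in>I. U i)" "inj_on (src G) (\<Union>i\<in>I. U i)"
      using assms(2) compact_open_G_setD(2,3) src rng by (intro *; blast)+
  qed (use assms(2) compact_open_G_setD in blast)+
qed

end

section \<open>Products of G-sets\<close>

definition gprod :: "('g, 'm) groupoid_scheme \<Rightarrow> 'g set \<Rightarrow> 'g set \<Rightarrow> 'g set" where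
  "gprod G U V = (\<lambda>(g, h). gmult G g h) ` (U \<times> V \<inter> composable G)"

context etale_groupoid
begin

lemma topspace_composable_space: "topspace (composable_space G) = composable G"
  by (auto simp: composable_space_def composable_iff topspace_gtop)

text \<open>An equaliser of continuous maps into a Hausdorff space. Closedness makes the composable
  pairs in a product of compact sets compact.\<close>

lemma closedin_composable: "closedin (prod_topology (gtop G) (gtop G)) (composable G)"
proof -
  have "composable G = {x \<in> topspace (prod_topology (gtop G) (gtop G)). (src G \<circ> fst) x = (rng G \<circ> snd) x}"
    by (auto simp: composable_iff topspace_gtop)
  then show ?thesis
    using closedin_continuous_maps_eq[OF Hausdorff_gtop
        continuous_map_compose[OF continuous_map_fst continuous_src_gtop]
        continuous_map_compose[OF continuous_map_snd continuous_rng_gtop]]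
    by simp
qed

lemma
  assumes U: "compact_open_G_set G U" and V: "compact_open_G_set G V"
  shows clopenin_pairs: "clopenin (composable_space G) (U \<times> V \<inter> composable G)"
    and compactin_pairs: "compactin (composable_space G) (U \<times> V \<inter> composable G)"
proof -
  let ?P = "prod_topology (gtop G) (gtop G)"
  note U = compact_open_G_setD[OF U] and V = compact_open_G_setD[OF V]
  have "openin ?P (U \<times> V)" "closedin ?P (U \<times> V)"
    using U(6) V(6) by (auto simp: openin_prod_Times_iff closedin_prod_Times_iff clopenin_def)
  then show "clopenin (composable_space G) (U \<times> V \<inter> composable G)"
    unfolding clopenin_def composable_space_def
    by (auto simp: openin_subtopology closedin_subtopology)
  have "compactin ?P (U \<times> V)"
    using U(4) V(4) by (simp add: compactin_Times)
  moreover have "closedin ?P (U \<times> V \<inter> composable G)"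
    using \<open>closedin ?P (U \<times> V)\<close> closedin_composable by blast
  ultimately have "compactin ?P (U \<times> V \<inter> composable G)"
    using closed_compactin[of ?P "U \<times> V"] by blast
  then show "compactin (composable_space G) (U \<times> V \<inter> composable G)"
    by (simp add: composable_space_def compactin_subtopology)
qed

text \<open>A continuous injection of a compact space into a Hausdorff space is a homeomorphism onto
  its image; \<open>p\<close> will be \<open>rng\<close> or \<open>src\<close>.\<close>

lemma homeomorphic_map_G_set:
  assumes U: "compact_open_G_set G U" and p: "continuous_map (gtop G) (unit_space G) p" "inj_on p U"
  shows "homeomorphic_map (subtopology (gtop G) U) (subtopology (unit_space G) (p ` U)) p"
proof (rule continuous_imp_homeomorphic_map)
  note U = compact_open_G_setD[OF U]
  show "continuous_map (subtopology (gtop G) U) (subtopology (unit_space G) (p ` U)) p"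
    using p(1) by (auto simp: continuous_map_in_subtopology continuous_map_from_subtopology)
  show "compact_space (subtopology (gtop G) U)"
    using U(4) by (simp add: compact_space_subtopology)
  show "Hausdorff_space (subtopology (unit_space G) (p ` U))"
    by (simp add: Hausdorff_space_subtopology Hausdorff_unit_space)
  have top: "topspace (subtopology (gtop G) U) = U"
    using U(1) by (auto simp: topspace_gtop)
  then show "p ` topspace (subtopology (gtop G) U) = topspace (subtopology (unit_space G) (p ` U))"
    using p(1) U(1) by (auto simp: continuous_map_def topspace_gtop)
  show "inj_on p (topspace (subtopology (gtop G) U))"
    using p(2) top by simp
qed

lemma rng_section:
  assumes "compact_open_G_set G U"
  obtains \<sigma> where "continuous_map (subtopology (unit_space G) (rng G ` U)) (gtop G) \<sigma>"
    "\<And>u. u \<in> U \<Longrightarrow> \<sigma> (rng G u) = u"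
proof -
  note U = compact_open_G_setD[OF assms]
  let ?X = "subtopology (gtop G) U" and ?Y = "subtopology (unit_space G) (rng G ` U)"
  have top: "topspace ?X = U" "topspace ?Y = rng G ` U"
    using U(1) rng_in_units by (auto simp: topspace_gtop topspace_unit_space)
  have "homeomorphic_map ?X ?Y (rng G)"
    by (rule homeomorphic_map_G_set[OF assms continuous_rng U(2)])
  then obtain \<sigma> where \<sigma>: "homeomorphic_maps ?X ?Y (rng G) \<sigma>"
    by (auto simp: homeomorphic_map_maps)
  then have "continuous_map ?Y (gtop G) \<sigma>" "\<And>u. u \<in> U \<Longrightarrow> \<sigma> (rng G u) = u"
    using top continuous_map_into_fulltopology by (auto simp: homeomorphic_maps_def)
  then show ?thesis
    using that by blast
qed

text \<open>If the range of \<open>k\<close> is a range of \<open>U\<close>, exactly one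
  \<open>u\<close> in \<open>U\<close> has the range of \<open>k\<close>, and \<open>k\<close> lies
  in the product iff the inverse of \<open>u\<close> times \<open>k\<close> lies in
  \<open>V\<close>. As \<open>u\<close> depends continuously on \<open>k\<close> through the section
  \<open>\<sigma>\<close>, the product is a preimage of \<open>V\<close>.\<close>

lemma openin_gprod:
  assumes "compact_open_G_set G U" "openin (gtop G) V"
  shows "openin (gtop G) (gprod G U V)"
proof -
  note U = compact_open_G_setD[OF assms(1)]
  have V: "V \<subseteq> arrows G"
    using openin_subset[OF assms(2)] topspace_gtop by simp
  obtain \<sigma> where \<sigma>: "continuous_map (subtopology (unit_space G) (rng G ` U)) (gtop G) \<sigma>"
    "\<And>u. u \<in> U \<Longrightarrow> \<sigma> (rng G u) = u"
    using rng_section[OF assms(1)] by metis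
  define W where "W = {k \<in> topspace (gtop G). rng G k \<in> rng G ` U}"
  define \<phi> where "\<phi> k = (ginv G (\<sigma> (rng G k)), k)" for k
  let ?X = "subtopology (gtop G) W"
  have W: "openin (gtop G) W"
    using clopenin_vimage[OF continuous_rng clopenin_rng_image[OF assms(1)]]
    by (simp add: W_def clopenin_def)
  have top: "topspace ?X = W"
    by (auto simp: W_def)
  have "continuous_map ?X (subtopology (unit_space G) (rng G ` U)) (rng G)"
    using continuous_rng by (auto simp: continuous_map_in_subtopology continuous_map_from_subtopology W_def)
  from continuous_map_compose[OF continuous_map_compose[OF this \<sigma>(1)] continuous_inv]
  have "continuous_map ?X (prod_topology (gtop G) (gtop G)) \<phi>"
    unfolding \<phi>_def by (intro continuous_map_pairedI) (simp_all add: o_def continuous_map_from_subtopology)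
  moreover have "\<phi> k \<in> composable G" if k: "k \<in> W" for k
    using k U(1) by (auto simp: W_def \<phi>_def composable_iff \<sigma>(2) topspace_gtop structure_simps subset_iff)
  ultimately have "continuous_map ?X (composable_space G) \<phi>"
    using top by (auto simp: composable_space_def continuous_map_in_subtopology)
  from continuous_map_compose[OF this continuous_mult]
  have cont: "continuous_map ?X (gtop G) (\<lambda>k. gmult G (ginv G (\<sigma> (rng G k))) k)"
    by (simp add: o_def \<phi>_def)
  have "gprod G U V = {k \<in> topspace ?X. gmult G (ginv G (\<sigma> (rng G k))) k \<in> V}" (is "_ = ?R")
  proof
    show "gprod G U V \<subseteq> ?R"
      unfolding gprod_def top W_def
      by (auto simp: topspace_gtop mult_closed rng_mult \<sigma>(2) inv_mult_cancel_left)
    show "?R \<subseteq> gprod G U V"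
    proof
      fix k assume "k \<in> ?R"
      then obtain u where u: "u \<in> U" "rng G k = rng G u" "k \<in> arrows G" "gmult G (ginv G u) k \<in> V"
        by (auto simp: top W_def \<sigma>(2) topspace_gtop)
      have u': "u \<in> arrows G"
        using u(1) U(1) by auto
      have "(ginv G u, k) \<in> composable G"
        using u u' by (simp add: composable_iff structure_simps)
      then have "(u, gmult G (ginv G u) k) \<in> composable G"
        using u u' by (simp add: composable_iff structure_simps)
      moreover have "gmult G u (gmult G (ginv G u) k) = k"
        using u u' by (simp add: mult_inv_cancel_left)
      ultimately show "k \<in> gprod G U V"
        unfolding gprod_def using u by (intro image_eqI[of _ _ "(u, gmult G (ginv G u) k)"]) auto
    qed
  qed
  then have "openin ?X (gprod G U V)"
    using openin_continuous_map_preimage[OF cont assms(2)] by simp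
  then show ?thesis
    using W openin_trans_full by blast
qed

text \<open>The range of a product determines the left factor, whose source is the range of the
  right factor and so determines that one too; from the source one argues in the opposite
  order.\<close>

lemma compact_open_G_set_gprod:
  assumes "compact_open_G_set G U" "compact_open_G_set G V"
  shows "compact_open_G_set G (gprod G U V)"
proof -
  note U = compact_open_G_setD[OF assms(1)] and V = compact_open_G_setD[OF assms(2)]
  have "inj_on (rng G) (gprod G U V)"
  proof (rule inj_onI, unfold gprod_def, clarsimp simp: rng_mult)
    fix g h g' h'
    assume *: "g \<in> U" "h \<in> V" "(g, h) \<in> composable G" "g' \<in> U" "h' \<in> V" "(g', h') \<in> composable G"
      "rng G g = rng G g'"
    then have "g = g'"
      using U(2) by (auto dest: inj_onD)
    moreover from this have "h = h'"
      using * V(2) by (auto dest: inj_onD simp: composable_iff)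
    ultimately show "gmult G g h = gmult G g' h'"
      by simp
  qed
  moreover have "inj_on (src G) (gprod G U V)"
  proof (rule inj_onI, unfold gprod_def, clarsimp simp: src_mult)
    fix g h g' h'
    assume *: "g \<in> U" "h \<in> V" "(g, h) \<in> composable G" "g' \<in> U" "h' \<in> V" "(g', h') \<in> composable G"
      "src G h = src G h'"
    then have "h = h'"
      using V(3) by (auto dest: inj_onD)
    moreover from this have "src G g = src G g'"
      using * by (simp add: composable_iff)
    then have "g = g'"
      using * U(3) by (auto dest: inj_onD)
    ultimately show "gmult G g h = gmult G g' h'"
      by simp
  qed
  moreover have "gprod G U V \<subseteq> arrows G"
    by (auto simp: gprod_def mult_closed)
  moreover have "compactin (gtop G) (gprod G U V)"
    unfolding gprod_def by (rule image_compactin[OF compactin_pairs[OF assms] continuous_mult])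
  ultimately show ?thesis
    using openin_gprod[OF assms(1) V(5)] by (simp add: compact_open_G_set_def G_set_def)
qed

lemma rng_image_gprod:
  assumes "U \<subseteq> arrows G" "V \<subseteq> arrows G"
  shows "rng G ` gprod G U V = rng G ` {g \<in> U. src G g \<in> rng G ` V}"
proof -
  have "rng G ` gprod G U V = (\<lambda>(g, h). rng G g) ` (U \<times> V \<inter> composable G)"
    unfolding gprod_def image_image by (rule image_cong) (auto simp: rng_mult)
  also have "\<dots> = rng G ` {g \<in> U. src G g \<in> rng G ` V}"
    using assms by (force simp: composable_iff image_iff)
  finally show ?thesis .
qed

lemma src_image_gprod:
  assumes "U \<subseteq> arrows G" "V \<subseteq> arrows G"
  shows "src G ` gprod G U V = src G ` {h \<in> V. rng G h \<in> src G ` U}"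
proof -
  have "src G ` gprod G U V = (\<lambda>(g, h). src G h) ` (U \<times> V \<inter> composable G)"
    unfolding gprod_def image_image by (rule image_cong) (auto simp: src_mult)
  also have "\<dots> = src G ` {h \<in> V. rng G h \<in> src G ` U}"
    using assms by (force simp: composable_iff image_iff)
  finally show ?thesis .
qed

section \<open>The chain complex in low degrees\<close>

lemma finite_fibres_rng: "f \<in> carrier (Cc (gtop G)) \<Longrightarrow> finite_fibres (gtop G) (rng G) f"
  by (erule finite_fibres_Cc) (metis rng_nhd topspace_gtop)

lemma finite_fibres_src: "f \<in> carrier (Cc (gtop G)) \<Longrightarrow> finite_fibres (gtop G) (src G) f"
  by (erule finite_fibres_Cc) (metis src_nhd topspace_gtop)

lemma \<delta>1_diff:
  assumes "f \<in> carrier (Cc (gtop G))" "g \<in> carrier (Cc (gtop G))"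
  shows "\<delta>1 G (f - g) = \<delta>1 G f - \<delta>1 G g"
  unfolding \<delta>1_def using assms
  by (simp add: pushforward_diff finite_fibres_rng finite_fibres_src fun_eq_iff)

lemma \<delta>1_sum:
  assumes "finite I" "\<And>i. i \<in> I \<Longrightarrow> f i \<in> carrier (Cc (gtop G))"
  shows "\<delta>1 G (\<Sum>i\<in>I. f i) = (\<Sum>i\<in>I. \<delta>1 G (f i))"
  using assms
proof (induction I rule: finite_induct)
  case empty
  show ?case
    using \<delta>1_diff[OF Cc_zero Cc_zero] by (simp only: sum.empty diff_self)
next
  case (insert i I)
  have S: "(\<Sum>i\<in>I. f i) \<in> carrier (Cc (gtop G))" "f i \<in> carrier (Cc (gtop G))"
    using insert.prems by (auto intro: Cc_sum)
  have "\<delta>1 G (f i) = \<delta>1 G ((f i + (\<Sum>i\<in>I. f i)) - (\<Sum>i\<in>I. f i))"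
    by simp
  also have "\<dots> = \<delta>1 G (f i + (\<Sum>i\<in>I. f i)) - \<delta>1 G (\<Sum>i\<in>I. f i)"
    by (rule \<delta>1_diff[OF Cc_add[OF S(2,1)] S(1)])
  finally have "\<delta>1 G (f i + (\<Sum>i\<in>I. f i)) = \<delta>1 G (f i) + \<delta>1 G (\<Sum>i\<in>I. f i)"
    by (simp only: eq_diff_eq)
  also have "\<delta>1 G (\<Sum>i\<in>I. f i) = (\<Sum>i\<in>I. \<delta>1 G (f i))"
    using insert by blast
  finally show ?case
    by (simp only: sum.insert[OF insert.hyps])
qed

lemma \<delta>1_indicator:
  assumes "compact_open_G_set G U"
  shows "\<delta>1 G (indicator U) = indicator (src G ` U) - indicator (rng G ` U)"
  unfolding \<delta>1_def using compact_open_G_setD[OF assms]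
  by (simp add: pushforward_indicator topspace_gtop fun_eq_iff)

lemma Cc_indicator_G_set: "compact_open_G_set G U \<Longrightarrow> indicator U \<in> carrier (Cc (gtop G))"
  by (simp add: Cc_indicator compact_open_G_setD)

text \<open>Inside a product of \<open>G\<close>-sets, any one of the vertices
  \<open>src G h\<close>, \<open>src G g = rng G h\<close> and \<open>rng G g\<close> determines the
  composable pair: it fixes one factor, and the shared vertex then fixes the other.\<close>

lemma composable_nhd:
  assumes "y \<in> topspace (composable_space G)"
  obtains N where "openin (composable_space G) N" "y \<in> N"
    "inj_on (\<lambda>y. src G (d0 y)) N" "inj_on (\<lambda>y. src G (d2 y)) N" "inj_on (\<lambda>y. rng G (d2 y)) N"
proof -
  obtain g h where y: "y = (g, h)" "(g, h) \<in> composable G"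
    using assms by (cases y) (auto simp: topspace_composable_space)
  obtain U where U: "openin (gtop G) U" "g \<in> U" "G_set G U"
    using G_set_nhd y(2) composable_iff by metis
  obtain V where V: "openin (gtop G) V" "h \<in> V" "G_set G V"
    using G_set_nhd y(2) composable_iff by metis
  let ?N = "U \<times> V \<inter> composable G"
  have "openin (composable_space G) ?N"
    unfolding composable_space_def openin_subtopology
    by (intro exI[of _ "U \<times> V"]) (use U(1) V(1) in \<open>simp add: openin_prod_Times_iff\<close>)
  moreover have "y \<in> ?N"
    using y U V by auto
  moreover have *: "g = g' \<and> h = h'"
    if "g \<in> U" "h \<in> V" "g' \<in> U" "h' \<in> V" "src G g = rng G h" "src G g' = rng G h'"
      "src G h = src G h' \<or> rng G h = rng G h' \<or> rng G g = rng G g'" for g h g' h'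
  proof -
    have inj: "inj_on (rng G) U" "inj_on (src G) U" "inj_on (rng G) V" "inj_on (src G) V"
      using U(3) V(3) by (simp_all add: G_set_def)
    show ?thesis
      using that by (metis inj[THEN inj_onD])
  qed
  have "inj_on (\<lambda>y. src G (d0 y)) ?N" "inj_on (\<lambda>y. src G (d2 y)) ?N"
      "inj_on (\<lambda>y. rng G (d2 y)) ?N"
    by (rule inj_onI, clarsimp simp: d0_def d2_def composable_iff, rule *; simp)+
  ultimately show ?thesis
    using that by blast
qed

lemma
  assumes "f \<in> carrier (Cc (composable_space G))"
  shows finite_fibres_src_d0: "finite_fibres (composable_space G) (\<lambda>y. src G (d0 y)) f"
    and finite_fibres_src_d2: "finite_fibres (composable_space G) (\<lambda>y. src G (d2 y)) f"
    and finite_fibres_rng_d2: "finite_fibres (composable_space G) (\<lambda>y. rng G (d2 y)) f"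
proof -
  have "finite_fibres (composable_space G) p f"
    if "p \<in> {\<lambda>y. src G (d0 y), \<lambda>y. src G (d2 y), \<lambda>y. rng G (d2 y)}" for p
  proof (rule finite_fibres_Cc[OF assms])
    fix y assume "y \<in> topspace (composable_space G)"
    then obtain N where N: "openin (composable_space G) N" "y \<in> N"
      "inj_on (\<lambda>y. src G (d0 y)) N" "inj_on (\<lambda>y. src G (d2 y)) N" "inj_on (\<lambda>y. rng G (d2 y)) N"
      by (rule composable_nhd)
    moreover have "inj_on p N"
      using that N(3-5) by (elim insertE emptyE) simp_all
    ultimately show "\<exists>N. openin (composable_space G) N \<and> y \<in> N \<and> inj_on p N"
      by blast
  qed
  then show "finite_fibres (composable_space G) (\<lambda>y. src G (d0 y)) f"
    "finite_fibres (composable_space G) (\<lambda>y. src G (d2 y)) f"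
    "finite_fibres (composable_space G) (\<lambda>y. rng G (d2 y)) f"
    by blast+
qed

text \<open>The simplicial identities: a composable pair is a triangle, each of whose vertices is
  reached through two faces.\<close>

lemma faces:
  assumes "y \<in> topspace (composable_space G)"
  shows "rng G (d0 y) = src G (d2 y)" "src G (d1 G y) = src G (d0 y)" "rng G (d1 G y) = rng G (d2 y)"
    "d0 y \<in> topspace (gtop G)" "d1 G y \<in> topspace (gtop G)" "d2 y \<in> topspace (gtop G)"
proof -
  obtain g h where "y = (g, h)" "(g, h) \<in> composable G"
    using assms topspace_composable_space by (cases y) auto
  then show "rng G (d0 y) = src G (d2 y)" "src G (d1 G y) = src G (d0 y)" "rng G (d1 G y) = rng G (d2 y)"
    "d0 y \<in> topspace (gtop G)" "d1 G y \<in> topspace (gtop G)" "d2 y \<in> topspace (gtop G)"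
    by (simp_all add: d0_def d1_def d2_def src_mult rng_mult mult_closed topspace_gtop composable_iff)
qed

lemma finite_fibres_faces_cong:
  "finite_fibres (composable_space G) (\<lambda>y. rng G (d0 y)) f = finite_fibres (composable_space G) (\<lambda>y. src G (d2 y)) f"
  "finite_fibres (composable_space G) (\<lambda>y. src G (d1 G y)) f = finite_fibres (composable_space G) (\<lambda>y. src G (d0 y)) f"
  "finite_fibres (composable_space G) (\<lambda>y. rng G (d1 G y)) f = finite_fibres (composable_space G) (\<lambda>y. rng G (d2 y)) f"
  "pushforward (composable_space G) (\<lambda>y. rng G (d0 y)) f = pushforward (composable_space G) (\<lambda>y. src G (d2 y)) f"
  "pushforward (composable_space G) (\<lambda>y. src G (d1 G y)) f = pushforward (composable_space G) (\<lambda>y. src G (d0 y)) f"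
  "pushforward (composable_space G) (\<lambda>y. rng G (d1 G y)) f = pushforward (composable_space G) (\<lambda>y. rng G (d2 y)) f"
proof -
  note cong = finite_fibres_cong[where Y = "composable_space G" and f = f]
  show "finite_fibres (composable_space G) (\<lambda>y. rng G (d0 y)) f = finite_fibres (composable_space G) (\<lambda>y. src G (d2 y)) f"
    by (rule cong(1)) (rule faces(1))
  show "finite_fibres (composable_space G) (\<lambda>y. src G (d1 G y)) f = finite_fibres (composable_space G) (\<lambda>y. src G (d0 y)) f"
    by (rule cong(1)) (rule faces(2))
  show "finite_fibres (composable_space G) (\<lambda>y. rng G (d1 G y)) f = finite_fibres (composable_space G) (\<lambda>y. rng G (d2 y)) f"
    by (rule cong(1)) (rule faces(3))
  show "pushforward (composable_space G) (\<lambda>y. rng G (d0 y)) f = pushforward (composable_space G) (\<lambda>y. src G (d2 y)) f"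
    by (rule cong(2)) (rule faces(1))
  show "pushforward (composable_space G) (\<lambda>y. src G (d1 G y)) f = pushforward (composable_space G) (\<lambda>y. src G (d0 y)) f"
    by (rule cong(2)) (rule faces(2))
  show "pushforward (composable_space G) (\<lambda>y. rng G (d1 G y)) f = pushforward (composable_space G) (\<lambda>y. rng G (d2 y)) f"
    by (rule cong(2)) (rule faces(3))
qed

context
  fixes f
  assumes f: "f \<in> carrier (Cc (composable_space G))"
begin

lemma finite_fibres_faces:
  "finite_fibres (composable_space G) (\<lambda>y. rng G (d0 y)) f"
  "finite_fibres (composable_space G) (\<lambda>y. src G (d1 G y)) f"
  "finite_fibres (composable_space G) (\<lambda>y. rng G (d1 G y)) f"
  unfolding finite_fibres_faces_cong
  by (rule finite_fibres_src_d0[OF f] finite_fibres_src_d2[OF f] finite_fibres_rng_d2[OF f])+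

lemma finite_fibres_d:
  "finite_fibres (composable_space G) d0 f"
  "finite_fibres (composable_space G) (d1 G) f"
  "finite_fibres (composable_space G) d2 f"
  by (rule finite_fibres_comp[where p = "src G"],
      rule finite_fibres_src_d0[OF f] finite_fibres_faces(2) finite_fibres_src_d2[OF f])+

text \<open>By \<open>faces\<close> the six pushforwards form three equal pairs, one per vertex, and
  the members of a pair carry opposite signs.\<close>

lemma \<delta>1_\<delta>2: "\<delta>1 G (\<delta>2 G f) = 0"
proof -
  let ?P = "\<lambda>d. pushforward (composable_space G) d f"
  note fin = finite_fibres_src_d0[OF f] finite_fibres_src_d2[OF f] finite_fibres_rng_d2[OF f]
    finite_fibres_faces
  have im: "d ` topspace (composable_space G) \<subseteq> topspace (gtop G)" if "d \<in> {d0, d1 G, d2}" for d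
    using that faces(4-6) by auto
  have eq: "\<delta>2 G f = ?P d0 - ?P (d1 G) + ?P d2"
    by (simp add: \<delta>2_def fun_eq_iff)
  have *: "pushforward (gtop G) p (\<delta>2 G f) =
      ?P (\<lambda>y. p (d0 y)) - ?P (\<lambda>y. p (d1 G y)) + ?P (\<lambda>y. p (d2 y))"
    if "finite_fibres (composable_space G) (\<lambda>y. p (d0 y)) f"
      "finite_fibres (composable_space G) (\<lambda>y. p (d1 G y)) f"
      "finite_fibres (composable_space G) (\<lambda>y. p (d2 y)) f" for p :: "'a \<Rightarrow> 'a"
    unfolding eq using that im
    by (simp add: pushforward_add pushforward_diff finite_fibres_diff finite_fibres_pushforward pushforward_comp)
  show ?thesis
    unfolding \<delta>1_def *[OF fin(1,5,2)] *[OF fin(4,6,3)]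
    by (simp add: finite_fibres_faces_cong fun_eq_iff)
qed

end

lemma \<delta>2_diff:
  assumes "f \<in> carrier (Cc (composable_space G))" "g \<in> carrier (Cc (composable_space G))"
  shows "\<delta>2 G (f - g) = \<delta>2 G f - \<delta>2 G g"
  using finite_fibres_d[OF assms(1)] finite_fibres_d[OF assms(2)]
  by (simp add: \<delta>2_def pushforward_diff fun_eq_iff)

end

section \<open>Homologous functions\<close>

text \<open>No membership in \<open>Cc\<close> is demanded, so chains of homologies between
  characteristic functions carry no side conditions; membership is asked for where
  \<open>\<delta>1\<close> is applied.\<close>

definition homologous :: "('g, 'm) groupoid_scheme \<Rightarrow> ('g \<Rightarrow> int) \<Rightarrow> ('g \<Rightarrow> int) \<Rightarrow> bool" where
  "homologous G f g \<longleftrightarrow> f - g \<in> boundaries1 G"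

context etale_groupoid
begin

lemma boundaries1_zero: "0 \<in> boundaries1 G"
proof -
  have "\<delta>2 G 0 = 0"
    by (simp add: \<delta>2_def fun_eq_iff)
  then show ?thesis
    unfolding boundaries1_def using Cc_zero by (metis image_eqI)
qed

lemma boundaries1_diff:
  assumes "f \<in> boundaries1 G" "g \<in> boundaries1 G"
  shows "f - g \<in> boundaries1 G"
proof -
  obtain f' g' where "f = \<delta>2 G f'" "f' \<in> carrier (Cc (composable_space G))"
    "g = \<delta>2 G g'" "g' \<in> carrier (Cc (composable_space G))"
    using assms by (auto simp: boundaries1_def)
  then show ?thesis
    unfolding boundaries1_def using Cc_diff \<delta>2_diff by (intro image_eqI[of _ _ "f' - g'"]) auto
qed

lemma boundaries1_uminus: "f \<in> boundaries1 G \<Longrightarrow> - f \<in> boundaries1 G"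
  using boundaries1_diff[OF boundaries1_zero] by simp

lemma boundaries1_add:
  assumes "f \<in> boundaries1 G" "g \<in> boundaries1 G"
  shows "f + g \<in> boundaries1 G"
  using boundaries1_diff[OF assms(1) boundaries1_uminus[OF assms(2)]] by simp

lemma homologous_refl: "homologous G f f"
  by (simp add: homologous_def boundaries1_zero)

lemma homologous_sym: "homologous G f g \<Longrightarrow> homologous G g f"
  unfolding homologous_def by (drule boundaries1_uminus) simp

lemma homologous_trans [trans]: "homologous G f g \<Longrightarrow> homologous G g h \<Longrightarrow> homologous G f h"
  unfolding homologous_def by (drule (1) boundaries1_add) simp

lemma homologous_eq_trans [trans]: "homologous G f g \<Longrightarrow> g = h \<Longrightarrow> homologous G f h"
  by simp

lemma eq_homologous_trans [trans]: "f = g \<Longrightarrow> homologous G g h \<Longrightarrow> homologous G f h"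
  by simp

lemma homologous_add: "homologous G f g \<Longrightarrow> homologous G f' g' \<Longrightarrow> homologous G (f + f') (g + g')"
  unfolding homologous_def by (drule (1) boundaries1_add) (simp add: algebra_simps)

lemma homologous_sum:
  "(\<And>i. i \<in> I \<Longrightarrow> homologous G (f i) (g i)) \<Longrightarrow> homologous G (\<Sum>i\<in>I. f i) (\<Sum>i\<in>I. g i)"
  by (induction I rule: infinite_finite_induct) (auto intro: homologous_refl homologous_add)

lemma \<delta>1_homologous:
  assumes "f \<in> carrier (Cc (gtop G))" "g \<in> carrier (Cc (gtop G))" "homologous G f g"
  shows "\<delta>1 G f = \<delta>1 G g"
proof -
  have "\<delta>1 G (f - g) = 0"
    using assms(3) \<delta>1_\<delta>2 by (auto simp: homologous_def boundaries1_def)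
  then show ?thesis
    using \<delta>1_diff[OF assms(1,2)] by simp
qed

text \<open>The boundary of the characteristic function of the composable pairs in \<open>U \<times> V\<close>.\<close>

lemma homologous_gprod:
  assumes U: "compact_open_G_set G U" and V: "compact_open_G_set G V"
  shows "homologous G (indicator (gprod G U V))
    (indicator {g \<in> U. src G g \<in> rng G ` V} + indicator {h \<in> V. rng G h \<in> src G ` U})"
proof -
  let ?S = "U \<times> V \<inter> composable G"
  note U = compact_open_G_setD[OF U] and V = compact_open_G_setD[OF V]
  have *: "g = g' \<and> h = h'"
    if "g \<in> U" "h \<in> V" "g' \<in> U" "h' \<in> V" "src G g = rng G h" "src G g' = rng G h'"
      "h = h' \<or> g = g' \<or> gmult G g h = gmult G g' h'" for g h g' h'
  proof -
    have "rng G (gmult G g h) = rng G g" "rng G (gmult G g' h') = rng G g'"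
      using that U(1) V(1) by (auto intro!: rng_mult simp: composable_iff)
    then have "rng G g = rng G g' \<or> h = h'"
      using that(7) by metis
    then show ?thesis
      using that by (metis U(2,3)[THEN inj_onD] V(2)[THEN inj_onD])
  qed
  have inj_d: "inj_on d ?S"
    if "\<And>g h g' h'. d (g, h) = d (g', h') \<Longrightarrow> h = h' \<or> g = g' \<or> gmult G g h = gmult G g' h'"
    for d :: "'a \<times> 'a \<Rightarrow> 'a"
  proof (rule inj_onI)
    fix x y assume xy: "x \<in> ?S" "y \<in> ?S" "d x = d y"
    obtain g h g' h' where eq: "x = (g, h)" "y = (g', h')"
      by (cases x; cases y)
    have "g = g' \<and> h = h'"
    proof (rule *)
      show "h = h' \<or> g = g' \<or> gmult G g h = gmult G g' h'"
        by (rule that) (use xy(3) eq in simp)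
    qed (use xy(1,2) in \<open>simp_all add: eq composable_iff\<close>)
    then show "x = y"
      by (simp add: eq)
  qed
  have inj: "inj_on d0 ?S" "inj_on (d1 G) ?S" "inj_on d2 ?S"
    by (rule inj_d, simp add: d0_def d1_def d2_def)+
  have im: "d0 ` ?S = {h \<in> V. rng G h \<in> src G ` U}" "d1 G ` ?S = gprod G U V"
    "d2 ` ?S = {g \<in> U. src G g \<in> rng G ` V}"
    using U(1) V(1) by (force simp: d0_def d1_def d2_def gprod_def composable_iff image_iff)+
  have "pushforward (composable_space G) d (indicator ?S) = indicator (d ` ?S)"
    if "inj_on d ?S" for d :: "'a \<times> 'a \<Rightarrow> 'a"
    using that by (intro pushforward_indicator) (simp_all add: topspace_composable_space)
  then have eq: "\<delta>2 G (indicator ?S) = indicator {g \<in> U. src G g \<in> rng G ` V} +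
      indicator {h \<in> V. rng G h \<in> src G ` U} - indicator (gprod G U V)"
    by (simp add: \<delta>2_def inj im fun_eq_iff)
  have "\<delta>2 G (indicator ?S) \<in> boundaries1 G"
    unfolding boundaries1_def using Cc_indicator[OF compactin_pairs clopenin_pairs] assms by blast
  then show ?thesis
    unfolding eq by - (rule homologous_sym, simp only: homologous_def)
qed

text \<open>The product of \<open>A\<close> with itself is \<open>A\<close>, so the product rule
  makes \<open>indicator A\<close> homologous to twice itself.\<close>

lemma homologous_unit:
  assumes A: "compact_open_G_set G A" and "A \<subseteq> gunits G"
  shows "homologous G (indicator A) 0"
proof -
  have A': "src G a = a" "rng G a = a" "a \<in> arrows G" "gmult G a a = a" if "a \<in> A" for a
    using that assms(2) units_arrows src_unit rng_unit rng_mult_left[of a] by auto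
  have "gprod G A A = A"
    using A' by (force simp: gprod_def composable_iff image_iff)
  moreover have "{a \<in> A. src G a \<in> rng G ` A} = A" "{a \<in> A. rng G a \<in> src G ` A} = A"
    using A' by force+
  ultimately have "homologous G (indicator A) (indicator A + indicator A)"
    using homologous_gprod[OF A A] by simp
  then have "homologous G (indicator A - indicator A) (indicator A + indicator A - indicator A)"
    unfolding homologous_def by simp
  then show ?thesis
    by - (rule homologous_sym, simp)
qed

text \<open>Injectivity of \<open>src\<close> on \<open>U\<close> means that an element of
  \<open>U\<close> is composable only with its own inverse.\<close>

lemma gprod_inv:
  assumes "compact_open_G_set G U"
  shows "gprod G U (ginv G ` U) = rng G ` U"
proof -
  note U = compact_open_G_setD[OF assms]
  have "gmult G g (ginv G g') = rng G g" if "g \<in> U" "g' \<in> U" "src G g = src G g'" for g g'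
    using that U(1,3) mult_inv_right by (metis inj_onD subsetD)
  then show ?thesis
    using U(1) inv_closed rng_inv mult_inv_right
    by (force simp: gprod_def composable_iff image_iff subset_iff)
qed

lemma homologous_inv:
  assumes unit: "compact_space (unit_space G)" and U: "compact_open_G_set G U"
  shows "homologous G (indicator (ginv G ` U)) (- indicator U)"
proof -
  have "U \<subseteq> arrows G"
    using compact_open_G_setD[OF U] by auto
  then have eq: "{g \<in> U. src G g \<in> rng G ` ginv G ` U} = U"
      "{h \<in> ginv G ` U. rng G h \<in> src G ` U} = ginv G ` U" "rng G ` U \<subseteq> gunits G"
    by (auto simp: image_rng_inv rng_inv rng_in_units subset_iff)
  \<comment> \<open>The product of \<open>U\<close> with its inverse is a set of units, so the class
    of this sum is zero.\<close>
  have "homologous G (indicator (rng G ` U)) (indicator U + indicator (ginv G ` U))"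
    using homologous_gprod[OF U compact_open_G_set_inv[OF U]] eq by (simp add: gprod_inv[OF U])
  moreover have "homologous G (indicator (rng G ` U)) 0"
    using compact_open_G_set_units[OF unit clopenin_rng_image[OF U]] eq by (intro homologous_unit)
  ultimately have "homologous G (indicator U + indicator (ginv G ` U)) 0"
    using homologous_sym homologous_trans by blast
  then show ?thesis
    by (simp add: homologous_def algebra_simps)
qed

section \<open>From balanced families to full G-sets\<close>

lemma compact_open_G_set_Un:
  assumes "compact_open_G_set G A" "compact_open_G_set G B"
    "src G ` A \<inter> src G ` B = {}" "rng G ` A \<inter> rng G ` B = {}"
  shows "compact_open_G_set G (A \<union> B)"
proof -
  have "compact_open_G_set G (\<Union>b\<in>UNIV. if b then A else B)"
    using assms by (intro compact_open_G_set_UN) (auto simp: Int_commute)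
  then show ?thesis
    by (simp add: UNIV_bool Un_commute)
qed

text \<open>Since source and range of \<open>T\<close> agree, the units outside that common set
  collide with neither, and adding them does not change the homology class.\<close>

lemma full_G_set_completion:
  assumes unit: "compact_space (unit_space G)"
    and T: "compact_open_G_set G T" "src G ` T = rng G ` T"
  obtains T' where "compact_open_G_set G T'" "src G ` T' = gunits G" "rng G ` T' = gunits G"
    "homologous G (indicator T') (indicator T)"
proof -
  define R where "R = gunits G - src G ` T"
  have TU: "src G ` T \<subseteq> gunits G"
    using compact_open_G_setD(1)[OF T(1)] src_in_units by auto
  have "clopenin (unit_space G) R"
    using clopenin_src_image[OF T(1)] topspace_unit_space unfolding R_def clopenin_def
    by (metis openin_diff closedin_diff openin_topspace closedin_topspace)
  then have R: "compact_open_G_set G R"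
    by (rule compact_open_G_set_units[OF unit])
  have RU: "R \<subseteq> gunits G" "src G ` R = R" "rng G ` R = R"
    by (auto simp: R_def src_unit rng_unit image_iff)
  have dis: "src G ` T \<inter> src G ` R = {}" "rng G ` T \<inter> rng G ` R = {}"
    unfolding RU using T(2) by (auto simp: R_def)
  then have "T \<inter> R = {}"
    by auto
  then have "indicator (T \<union> R) = (indicator T + indicator R :: 'a \<Rightarrow> int)"
    by (auto simp: indicator_def fun_eq_iff)
  also have "homologous G (indicator T + indicator R) (indicator T + 0)"
    by (intro homologous_add homologous_refl homologous_unit R RU)
  finally show ?thesis
    using that[OF compact_open_G_set_Un[OF T(1) R dis]] T(2) TU RU
    by (auto simp: image_Un R_def)
qed

text \<open>
  Conjugating \<open>U j\<close> by members of a family \<open>W\<close> with disjoint ranges separates the sources and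
  the ranges without changing the homology class: in the sum over \<open>j\<close>, the correction terms for
  the sources and for the ranges cancel by the balance condition.
\<close>

lemma full_G_set_of_family:
  fixes U :: "'j \<Rightarrow> 'a set" and W :: "nat \<Rightarrow> 'a set" and a b :: "'j \<Rightarrow> nat"
  assumes unit: "compact_space (unit_space G)"
    and J: "finite J" and U: "\<And>j. j \<in> J \<Longrightarrow> compact_open_G_set G (U j)"
    and W: "\<And>n. compact_open_G_set G (W n)" and src_W: "\<And>n. src G ` W n = gunits G"
    and rng_W: "\<And>m n. m \<noteq> n \<Longrightarrow> rng G ` W m \<inter> rng G ` W n = {}"
    and src_U: "\<And>i j. i \<in> J \<Longrightarrow> j \<in> J \<Longrightarrow> i \<noteq> j \<Longrightarrow> a i = a j \<Longrightarrow> src G ` U i \<inter> src G ` U j = {}"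
    and rng_U: "\<And>i j. i \<in> J \<Longrightarrow> j \<in> J \<Longrightarrow> i \<noteq> j \<Longrightarrow> b i = b j \<Longrightarrow> rng G ` U i \<inter> rng G ` U j = {}"
    and balance: "\<And>n. (\<Union>j\<in>{j \<in> J. a j = n}. src G ` U j) = (\<Union>j\<in>{j \<in> J. b j = n}. rng G ` U j)"
  obtains T where "compact_open_G_set G T" "src G ` T = gunits G" "rng G ` T = gunits G"
    "homologous G (indicator T) (\<Sum>j\<in>J. indicator (U j))"
proof -
  \<comment> \<open>\<open>E n A\<close> is the part of \<open>W n\<close> over \<open>A\<close>.
    The source and the range of each conjugated piece \<open>T j\<close> will be ranges of such
    parts, with \<open>A\<close> the source or the range of \<open>U j\<close>.\<close>
  define E where "E n A = {w \<in> W n. src G w \<in> A}" for n A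
  define V where "V j = gprod G (U j) (ginv G ` W (a j))" for j
  define T where "T j = gprod G (W (b j)) (V j)" for j
  have WA: "W n \<subseteq> arrows G" for n
    using compact_open_G_setD(1)[OF W] .
  have UA: "U j \<subseteq> arrows G" "src G ` U j \<subseteq> gunits G" "rng G ` U j \<subseteq> gunits G" if "j \<in> J" for j
    using compact_open_G_setD(1)[OF U[OF that]] src_in_units rng_in_units by auto
  have W': "compact_open_G_set G (ginv G ` W n)" "ginv G ` W n \<subseteq> arrows G"
    "rng G ` ginv G ` W n = gunits G" for n
    using compact_open_G_set_inv[OF W] compact_open_G_setD(1) image_rng_inv[OF WA] src_W by auto
  have V: "compact_open_G_set G (V j)" and T: "compact_open_G_set G (T j)" if "j \<in> J" for j
    using that unfolding V_def T_def by (simp_all add: compact_open_G_set_gprod U W W')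
  have VA: "V j \<subseteq> arrows G" if "j \<in> J" for j
    using compact_open_G_setD(1)[OF V[OF that]] .
  have E: "compact_open_G_set G (E (a j) (src G ` U j))" if "j \<in> J" for j
    unfolding E_def
    by (rule compact_open_G_set_src_restrict[OF W clopenin_src_image[OF U[OF that]]])
  have inv_E: "{h \<in> ginv G ` W n. rng G h \<in> A} = ginv G ` E n A" for n A
    using WA[of n] by (auto simp: E_def rng_inv subset_iff)
  have EA: "E n A \<subseteq> arrows G" for n A
    using WA by (auto simp: E_def)
  have rng_V: "rng G ` V j = rng G ` U j" and src_V: "src G ` V j = rng G ` E (a j) (src G ` U j)"
    if "j \<in> J" for j
  proof -
    have "{g \<in> U j. src G g \<in> rng G ` ginv G ` W (a j)} = U j"
      using UA(2)[OF that] W'(3) by auto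
    then show "rng G ` V j = rng G ` U j"
      unfolding V_def by (simp only: rng_image_gprod[OF UA(1)[OF that] W'(2)])
    show "src G ` V j = rng G ` E (a j) (src G ` U j)"
      unfolding V_def by (simp only: src_image_gprod[OF UA(1)[OF that] W'(2)] inv_E image_src_inv[OF EA])
  qed
  \<comment> \<open>The sources of the \<open>W n\<close> are full, so every arrow of
    \<open>V j\<close> survives in the product.\<close>
  have VU: "{h \<in> V j. rng G h \<in> src G ` W n} = V j" if "j \<in> J" for j n
    using rng_in_units VA[OF that] src_W by auto
  have src_T: "src G ` T j = rng G ` E (a j) (src G ` U j)"
    and rng_T: "rng G ` T j = rng G ` E (b j) (rng G ` U j)" if "j \<in> J" for j
    unfolding T_def using src_V rng_V that
    by (simp_all only: src_image_gprod[OF WA VA[OF that]] rng_image_gprod[OF WA VA[OF that]] VU[OF that] E_def)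
  \<comment> \<open>Parts of different \<open>W n\<close> have disjoint ranges by
    \<open>rng_W\<close>; inside one \<open>W n\<close>, injectivity of \<open>rng\<close> transfers
    the disjointness of \<open>A\<close> and \<open>B\<close>.\<close>
  have E_disj: "rng G ` E m A \<inter> rng G ` E n B = {}" if AB: "m = n \<Longrightarrow> A \<inter> B = {}" for m n A B
  proof (rule equals0I)
    fix x assume "x \<in> rng G ` E m A \<inter> rng G ` E n B"
    then obtain w w' where w: "w \<in> W m" "src G w \<in> A" "w' \<in> W n" "src G w' \<in> B" "rng G w = rng G w'"
      by (auto simp: E_def)
    then have "m = n"
      using rng_W[of m n] by (metis IntI empty_iff imageI)
    moreover from this have "w = w'"
      using w compact_open_G_setD(2)[OF W] by (auto dest: inj_onD)
    ultimately show False
      using AB w by auto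
  qed
  have E_src: "rng G ` E (a i) (src G ` U i) \<inter> rng G ` E (a j) (src G ` U j) = {}"
    and E_rng: "rng G ` E (b i) (rng G ` U i) \<inter> rng G ` E (b j) (rng G ` U j) = {}"
    if "i \<in> J" "j \<in> J" "i \<noteq> j" for i j
    by (rule E_disj, rule src_U[OF that], assumption) (rule E_disj, rule rng_U[OF that], assumption)
  have disj: "src G ` T i \<inter> src G ` T j = {}" "rng G ` T i \<inter> rng G ` T j = {}"
    if "i \<in> J" "j \<in> J" "i \<noteq> j" for i j
    using E_src[OF that] E_rng[OF that] that by (simp_all only: src_T rng_T)
  define S where "S = (\<Union>j\<in>J. T j)"
  have S: "compact_open_G_set G S"
    unfolding S_def by (rule compact_open_G_set_UN[OF J T disj])
  \<comment> \<open>\<open>E n\<close> commutes with unions, so the parts can be grouped by their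
    index; \<open>balance\<close> then equates the groups one by one.\<close>
  have UN_E: "(\<Union>j\<in>J. E (b j) (rng G ` U j)) = (\<Union>j\<in>J. E (a j) (src G ` U j))"
  proof -
    have *: "(\<Union>j\<in>J. E (c j) (A j)) = (\<Union>n. E n (\<Union>j\<in>{j \<in> J. c j = n}. A j))"
      for c :: "'j \<Rightarrow> nat" and A :: "'j \<Rightarrow> 'a set"
      by (auto simp: E_def)
    show ?thesis
      unfolding * balance ..
  qed
  have "src G ` S = rng G ` (\<Union>j\<in>J. E (a j) (src G ` U j))"
    unfolding S_def image_UN by (intro SUP_cong refl src_T)
  also have "\<dots> = rng G ` (\<Union>j\<in>J. E (b j) (rng G ` U j))"
    by (simp only: UN_E)
  also have "\<dots> = rng G ` S"
    unfolding S_def image_UN by (intro SUP_cong refl rng_T[symmetric])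
  finally have S_bal: "src G ` S = rng G ` S" .
  have indicator_UN: "indicator (\<Union>j\<in>J. F j) = (\<Sum>j\<in>J. indicator (F j) :: 'a \<Rightarrow> int)"
    if "\<And>i j. i \<in> J \<Longrightarrow> j \<in> J \<Longrightarrow> i \<noteq> j \<Longrightarrow> rng G ` F i \<inter> rng G ` F j = {}" for F
  proof -
    have "disjoint_family_on F J"
      unfolding disjoint_family_on_def
      by (metis (no_types, lifting) that disjoint_iff imageI)
    then show ?thesis
      by (rule indicator_UN_disjoint_fun[OF J])
  qed
  \<comment> \<open>By disjointness both sums are characteristic functions of the one set in
    \<open>UN_E\<close>.\<close>
  have corr: "(\<Sum>j\<in>J. indicator (E (b j) (rng G ` U j))) = (\<Sum>j\<in>J. indicator (E (a j) (src G ` U j)) :: 'a \<Rightarrow> int)"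
    (is "?L = ?R")
  proof -
    have "?L = indicator (\<Union>j\<in>J. E (b j) (rng G ` U j))"
      by (rule indicator_UN[symmetric]) (rule E_rng)
    also have "\<dots> = ?R"
      unfolding UN_E by (rule indicator_UN) (rule E_src)
    finally show ?thesis .
  qed
  \<comment> \<open>Multiplying by \<open>W (b j)\<close> on the left adds its part over the range
    of \<open>U j\<close>; multiplying by the inverse of \<open>W (a j)\<close> on the right
    subtracts its part over the source.\<close>
  have T_hom: "homologous G (indicator (T j))
      (indicator (U j) + (indicator (E (b j) (rng G ` U j)) - indicator (E (a j) (src G ` U j))))"
    if j: "j \<in> J" for j
  proof -
    have "{g \<in> U j. src G g \<in> rng G ` ginv G ` W (a j)} = U j"
      using UA(2)[OF j] W'(3) by auto
    then have "homologous G (indicator (V j)) (indicator (U j) + indicator (ginv G ` E (a j) (src G ` U j)))"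
      using homologous_gprod[OF U[OF j] W'(1)[of "a j"]] by (simp only: V_def inv_E)
    also have "homologous G \<dots> (indicator (U j) + - indicator (E (a j) (src G ` U j)))"
      by (intro homologous_add homologous_refl homologous_inv unit E j)
    finally have Vh: "homologous G (indicator (V j)) \<dots>" .
    have "homologous G (indicator (T j)) (indicator (E (b j) (rng G ` U j)) + indicator (V j))"
      using homologous_gprod[OF W[of "b j"] V[OF j]] by (simp only: T_def VU[OF j] rng_V[OF j] E_def)
    also have "homologous G \<dots> (indicator (E (b j) (rng G ` U j)) +
        (indicator (U j) + - indicator (E (a j) (src G ` U j))))"
      by (intro homologous_add homologous_refl Vh)
    finally show ?thesis
      by (simp add: algebra_simps)
  qed
  have "indicator S = (\<Sum>j\<in>J. indicator (T j) :: 'a \<Rightarrow> int)"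
    unfolding S_def by (rule indicator_UN) (rule disj)
  also have "homologous G \<dots> (\<Sum>j\<in>J. indicator (U j) +
      (indicator (E (b j) (rng G ` U j)) - indicator (E (a j) (src G ` U j))))"
    by (intro homologous_sum T_hom)
  also have "\<dots> = (\<Sum>j\<in>J. indicator (U j))"
    by (simp only: sum.distrib sum_subtractf corr) simp
  finally have S_hom: "homologous G (indicator S) (\<Sum>j\<in>J. indicator (U j))" .
  obtain T' where "compact_open_G_set G T'" "src G ` T' = gunits G" "rng G ` T' = gunits G"
    "homologous G (indicator T') (indicator S)"
    using full_G_set_completion[OF unit S S_bal] by metis
  then show ?thesis
    using that S_hom homologous_trans by blast
qed

end

section \<open>Representing a cycle by a full G-set\<close>

text \<open>One function in two roles: for \<open>x\<close> in \<open>A i\<close> the value at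
  \<open>i\<close> is the label of \<open>x\<close> in \<open>A i\<close>, and the value at
  \<open>n\<close> is the multiplicity of \<open>x\<close> in the first \<open>n\<close>
  sets.\<close>

definition hits :: "(nat \<Rightarrow> 'a set) \<Rightarrow> nat \<Rightarrow> 'a \<Rightarrow> nat" where
  "hits A i x = (\<Sum>j<i. indicator (A j) x)"

lemma hits_0 [simp]: "hits A 0 x = 0"
  by (simp add: hits_def)

lemma hits_Suc [simp]: "hits A (Suc i) x = hits A i x + indicator (A i) x"
  by (simp add: hits_def)

lemma hits_le: "hits A i x \<le> i"
  by (induction i) (auto simp: indicator_def)

lemma hits_strict_mono: "x \<in> A i \<Longrightarrow> i < k \<Longrightarrow> hits A i x < hits A k x"
  by (induction k) (auto simp: less_Suc_eq)

text \<open>The count grows in steps of at most one, so it passes every \<open>m\<close> below its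
  final value, and it leaves \<open>m\<close> at an index \<open>i\<close> whose set contains
  \<open>x\<close>.\<close>

lemma less_hits_iff: "m < hits A n x \<longleftrightarrow> (\<exists>i<n. x \<in> A i \<and> hits A i x = m)"
  by (induction n) (auto simp: less_Suc_eq indicator_def)

text \<open>The count strictly increases on passing a set that contains \<open>x\<close>, so the
  labels of \<open>x\<close> do not repeat.\<close>

lemma hits_inj:
  assumes "x \<in> A i" "x \<in> A k" "hits A i x = hits A k x"
  shows "i = k"
  using assms hits_strict_mono[of x A i k] hits_strict_mono[of x A k i]
  by (cases i k rule: linorder_cases) auto

lemma continuous_map_hits:
  assumes "\<And>i. i < n \<Longrightarrow> clopenin X (A i)"
  shows "continuous_map X (discrete_topology UNIV) (hits A n)"
proof -
  have "continuous_map X (discrete_topology UNIV) (\<lambda>x. \<Sum>j<n. indicator (A j) x :: nat)"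
    using assms by (intro continuous_map_discrete_sum continuous_map_indicator) auto
  then show ?thesis
    by (simp add: hits_def[abs_def])
qed

context etale_groupoid
begin

text \<open>The sets are \<open>V\<close>, \<open>U V\<close>, \<open>U U V\<close> and so on. As
  \<open>rng\<close> is injective on \<open>U\<close>, common left factors can be stripped until one
  of the two sets is \<open>V\<close> and the other has its range inside that of
  \<open>U\<close>.\<close>

lemma disjoint_ranges_family:
  assumes "properly_infinite G (gunits G)"
  obtains W :: "nat \<Rightarrow> 'a set" where "\<And>n. compact_open_G_set G (W n)" "\<And>n. src G ` W n = gunits G"
    "\<And>m n. m \<noteq> n \<Longrightarrow> rng G ` W m \<inter> rng G ` W n = {}"
proof -
  obtain U V where U: "compact_open_G_set G U" and V: "compact_open_G_set G V"
    and src: "src G ` U = gunits G" "src G ` V = gunits G"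
    and disj: "rng G ` U \<inter> rng G ` V = {}"
    using assms by (auto simp: properly_infinite_def)
  define W where "W n = (gprod G U ^^ n) V" for n
  have W0: "W 0 = V" and WSuc: "W (Suc n) = gprod G U (W n)" for n
    by (simp_all add: W_def)
  have W: "compact_open_G_set G (W n)" for n
    by (induction n) (simp_all add: W0 WSuc U V compact_open_G_set_gprod)
  have arr: "U \<subseteq> arrows G" "W n \<subseteq> arrows G" for n
    using compact_open_G_setD(1)[OF U] compact_open_G_setD(1)[OF W] by auto
  have "src G ` W n = gunits G" for n
  proof (induction n)
    case (Suc n)
    have "{h \<in> W n. rng G h \<in> src G ` U} = W n"
      using arr(2) rng_in_units src by auto
    then show ?case
      using Suc by (simp add: WSuc src_image_gprod[OF arr])
  qed (simp add: W0 src)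
  moreover have "rng G ` W m \<inter> rng G ` W n = {}" if "m \<noteq> n" for m n
    using that
  proof (induction m arbitrary: n)
    case 0
    then obtain k where "n = Suc k"
      by (cases n) auto
    then have "rng G ` W n \<subseteq> rng G ` U"
      by (auto simp: WSuc rng_image_gprod[OF arr])
    then show ?case
      using disj by (auto simp: W0)
  next
    case (Suc m)
    show ?case
    proof (cases n)
      case 0
      have "rng G ` W (Suc m) \<subseteq> rng G ` U"
        by (auto simp: WSuc rng_image_gprod[OF arr])
      then show ?thesis
        using disj by (auto simp: W0 0)
    next
      case (Suc k)
      then have IH: "rng G ` W m \<inter> rng G ` W k = {}"
        using Suc.IH Suc.prems by simp
      show ?thesis
      proof (rule equals0I)
        fix x assume "x \<in> rng G ` W (Suc m) \<inter> rng G ` W n"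
        then obtain g g' where g: "g \<in> U" "src G g \<in> rng G ` W m" "g' \<in> U" "src G g' \<in> rng G ` W k"
          "rng G g = rng G g'"
          by (auto simp: WSuc Suc rng_image_gprod[OF arr])
        then have "g = g'"
          using compact_open_G_setD(2)[OF U] by (auto dest: inj_onD)
        then show False
          using g IH by blast
      qed
    qed
  qed
  ultimately show ?thesis
    using that W by blast
qed

text \<open>
  Label an arrow of \<open>U i\<close> by the number of \<open>j < i\<close> whose source set contains its source, and
  likewise for ranges. Cutting along these labels yields a family to which
  \<open>full_G_set_of_family\<close> applies: the sources labelled \<open>m\<close> are the points of multiplicity
  greater than \<open>m\<close>, and for a cycle the multiplicities of sources and ranges agree.
\<close>

lemma full_G_set_of_cycle:
  fixes U :: "nat \<Rightarrow> 'a set"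
  assumes unit: "compact_space (unit_space G)" and inf: "properly_infinite G (gunits G)"
    and U: "\<And>i. i < n \<Longrightarrow> compact_open_G_set G (U i)"
    and cycle: "\<And>x. hits (\<lambda>i. src G ` U i) n x = hits (\<lambda>i. rng G ` U i) n x"
  obtains T where "compact_open_G_set G T" "src G ` T = gunits G" "rng G ` T = gunits G"
    "homologous G (indicator T) (\<Sum>i<n. indicator (U i))"
proof -
  define A where "A i = src G ` U i" for i
  define B where "B i = rng G ` U i" for i
  \<comment> \<open>A label at index \<open>i\<close> is at most \<open>i\<close>, hence below
    \<open>n\<close>, so this square contains all pairs of labels.\<close>
  define K where "K = {..<n} \<times> {..<n}"
  define U' where "U' = (\<lambda>(i, a, b). {g \<in> U i. hits A i (src G g) = a \<and> hits B i (rng G g) = b})"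
  define J where "J = {..<n} \<times> K"
  obtain W :: "nat \<Rightarrow> 'a set" where W: "\<And>n. compact_open_G_set G (W n)" "\<And>n. src G ` W n = gunits G"
    "\<And>m n. m \<noteq> n \<Longrightarrow> rng G ` W m \<inter> rng G ` W n = {}"
    using disjoint_ranges_family[OF inf] by metis
  have lt: "hits C i x < n" if "i < n" for C :: "nat \<Rightarrow> 'a set" and i x
    using hits_le[of C i x] that by simp
  have "(\<Sum>i<n. indicator (U i) :: 'a \<Rightarrow> int) = (\<Sum>i<n. \<Sum>p\<in>K. indicator (U' (i, p)))"
  proof (rule sum.cong[OF refl])
    fix i assume i: "i \<in> {..<n}"
    have "disjoint_family_on (\<lambda>p. U' (i, p)) K"
      by (auto simp: disjoint_family_on_def U'_def)
    moreover have "(\<Union>p\<in>K. U' (i, p)) = U i"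
      using i lt by (auto simp: U'_def K_def)
    ultimately show "(indicator (U i) :: 'a \<Rightarrow> int) = (\<Sum>p\<in>K. indicator (U' (i, p)))"
      using indicator_UN_disjoint_fun[of K "\<lambda>p. U' (i, p)"] by (simp add: K_def)
  qed
  also have "\<dots> = (\<Sum>j\<in>J. indicator (U' j))"
    by (simp add: J_def sum.cartesian_product)
  finally have sum_eq: "(\<Sum>j\<in>J. indicator (U' j)) = (\<Sum>i<n. indicator (U i) :: 'a \<Rightarrow> int)" ..
  have cog: "compact_open_G_set G (U' j)" if j: "j \<in> J" for j
  proof -
    obtain i a b where eq: "j = (i, a, b)" and i: "i < n"
      using j by (auto simp: J_def)
    \<comment> \<open>The labels are continuous on the unit space, so cutting along them leaves
      compact open pieces.\<close>
    have "continuous_map (unit_space G) (discrete_topology UNIV) (hits A i)"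
      "continuous_map (unit_space G) (discrete_topology UNIV) (hits B i)"
      using i U by (auto intro!: continuous_map_hits clopenin_src_image clopenin_rng_image simp: A_def B_def)
    then have "clopenin (gtop G) {g \<in> topspace (gtop G). (hits A i \<circ> src G) g = a}"
      "clopenin (gtop G) {g \<in> topspace (gtop G). (hits B i \<circ> rng G) g = b}"
      using continuous_src continuous_rng by (blast intro: clopenin_eq continuous_map_compose)+
    then have "compact_open_G_set G {g \<in> {g \<in> U i. hits A i (src G g) = a}. hits B i (rng G g) = b}"
      using U[OF i] by (intro compact_open_G_set_restrict) simp_all
    moreover have "{g \<in> {g \<in> U i. hits A i (src G g) = a}. hits B i (rng G g) = b} = U' j"
      by (auto simp: U'_def eq)
    ultimately show ?thesis
      by simp
  qed
  have inj: "inj_on (src G) (U i)" "inj_on (rng G) (U i)" if "i < n" for i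
    using compact_open_G_setD[OF U[OF that]] by auto
  have src_disj: "src G ` U' j \<inter> src G ` U' k = {}"
    if jk: "j \<in> J" "k \<in> J" "j \<noteq> k" "fst (snd j) = fst (snd k)" for j k
  proof (rule equals0I)
    fix x assume x: "x \<in> src G ` U' j \<inter> src G ` U' k"
    obtain i a b i' b' where eq: "j = (i, a, b)" "k = (i', a, b')" and i: "i < n"
      using jk by (cases j; cases k) (auto simp: J_def)
    obtain g g' where g: "g \<in> U i" "g' \<in> U i'" "src G g = x" "src G g' = x"
      "hits A i x = a" "hits A i' x = a" "hits B i (rng G g) = b" "hits B i' (rng G g') = b'"
      using x by (auto simp: U'_def eq)
    have "x \<in> A i" "x \<in> A i'"
      unfolding A_def using imageI[OF g(1), of "src G"] imageI[OF g(2), of "src G"] g(3,4) by simp_all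
    \<comment> \<open>Equal labels of one point force equal indices. Then \<open>g = g'\<close>, so
      the range labels agree as well, against \<open>j \<noteq> k\<close>.\<close>
    then have "i = i'"
      using g(5,6) by - (rule hits_inj[of x A], simp_all)
    moreover from this have "g = g'"
      using g inj(1)[OF i] by (auto dest: inj_onD)
    ultimately show False
      using g jk(3) eq by simp
  qed
  have rng_disj: "rng G ` U' j \<inter> rng G ` U' k = {}"
    if jk: "j \<in> J" "k \<in> J" "j \<noteq> k" "snd (snd j) = snd (snd k)" for j k
  proof (rule equals0I)
    fix x assume x: "x \<in> rng G ` U' j \<inter> rng G ` U' k"
    obtain i a b i' a' where eq: "j = (i, a, b)" "k = (i', a', b)" and i: "i < n"
      using jk by (cases j; cases k) (auto simp: J_def)
    obtain g g' where g: "g \<in> U i" "g' \<in> U i'" "rng G g = x" "rng G g' = x"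
      "hits B i x = b" "hits B i' x = b" "hits A i (src G g) = a" "hits A i' (src G g') = a'"
      using x by (auto simp: U'_def eq)
    have "x \<in> B i" "x \<in> B i'"
      unfolding B_def using imageI[OF g(1), of "rng G"] imageI[OF g(2), of "rng G"] g(3,4) by simp_all
    then have "i = i'"
      using g(5,6) by - (rule hits_inj[of x B], simp_all)
    moreover from this have "g = g'"
      using g inj(2)[OF i] by (auto dest: inj_onD)
    ultimately show False
      using g jk(3) eq by simp
  qed
  have src_un: "(\<Union>j\<in>{j \<in> J. fst (snd j) = m}. src G ` U' j) = {x. m < hits A n x}" for m
  proof (intro equalityI subsetI)
    fix x assume "x \<in> (\<Union>j\<in>{j \<in> J. fst (snd j) = m}. src G ` U' j)"
    then show "x \<in> {x. m < hits A n x}"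
      by (auto simp: U'_def J_def A_def less_hits_iff)
  next
    fix x assume "x \<in> {x. m < hits A n x}"
    then obtain i g where i: "i < n" "hits A i x = m" "g \<in> U i" "x = src G g"
      by (auto simp: less_hits_iff A_def)
    \<comment> \<open>Only the source label is prescribed; the range label is read off from the
      arrow \<open>g\<close>.\<close>
    then have "g \<in> U' (i, m, hits B i (rng G g))" "(i, m, hits B i (rng G g)) \<in> J"
      using lt[of i A x] lt[of i B "rng G g"] by (auto simp: U'_def J_def K_def)
    then show "x \<in> (\<Union>j\<in>{j \<in> J. fst (snd j) = m}. src G ` U' j)"
      using i(4) by force
  qed
  have rng_un: "(\<Union>j\<in>{j \<in> J. snd (snd j) = m}. rng G ` U' j) = {x. m < hits B n x}" for m
  proof (intro equalityI subsetI)
    fix x assume "x \<in> (\<Union>j\<in>{j \<in> J. snd (snd j) = m}. rng G ` U' j)"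
    then show "x \<in> {x. m < hits B n x}"
      by (auto simp: U'_def J_def B_def less_hits_iff)
  next
    fix x assume "x \<in> {x. m < hits B n x}"
    then obtain i g where i: "i < n" "hits B i x = m" "g \<in> U i" "x = rng G g"
      by (auto simp: less_hits_iff B_def)
    then have "g \<in> U' (i, hits A i (src G g), m)" "(i, hits A i (src G g), m) \<in> J"
      using lt[of i B x] lt[of i A "src G g"] by (auto simp: U'_def J_def K_def)
    then show "x \<in> (\<Union>j\<in>{j \<in> J. snd (snd j) = m}. rng G ` U' j)"
      using i(4) by force
  qed
  have AB: "hits A n = hits B n"
    unfolding A_def B_def using cycle by (simp add: fun_eq_iff)
  have balance: "(\<Union>j\<in>{j \<in> J. fst (snd j) = m}. src G ` U' j) =
      (\<Union>j\<in>{j \<in> J. snd (snd j) = m}. rng G ` U' j)" for m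
    by (simp only: src_un rng_un AB)
  have "finite J"
    by (simp add: J_def K_def)
  from full_G_set_of_family[of J U' W "\<lambda>j. fst (snd j)" "\<lambda>j. snd (snd j)",
      OF unit this cog W src_disj rng_disj balance]
  obtain T where "compact_open_G_set G T" "src G ` T = gunits G" "rng G ` T = gunits G"
    "homologous G (indicator T) (\<Sum>j\<in>J. indicator (U' j))"
    by blast
  then show ?thesis
    by (intro that[of T]) (simp_all only: sum_eq)
qed

end

text \<open>A list, because a set may have to be repeated. There are no signs: negative multiples
  are realised by inverses.\<close>

definition sum_of_G_sets :: "('g, 'm) groupoid_scheme \<Rightarrow> ('g \<Rightarrow> int) \<Rightarrow> bool" where
  "sum_of_G_sets G f \<longleftrightarrow>
     (\<exists>Us. (\<forall>U\<in>set Us. compact_open_G_set G U) \<and> homologous G f (sum_list (map indicator Us)))"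

section \<open>Decomposition of functions and cycles into compact open G-sets\<close>

context etale_groupoid
begin

text \<open>Inside the range of a \<open>G\<close>-set neighbourhood \<open>V\<close> of
  \<open>g\<close>, total disconnectedness of the unit space gives a clopen \<open>A\<close> around
  \<open>rng G g\<close>. The arrows of \<open>V\<close> over \<open>A\<close> are homeomorphic to
  \<open>A\<close>, hence compact.\<close>

lemma compact_open_G_set_nhd:
  assumes cantor: "cantor_space (unit_space G)" and W: "openin (gtop G) W" "g \<in> W"
  obtains U where "compact_open_G_set G U" "g \<in> U" "U \<subseteq> W"
proof -
  have "g \<in> arrows G"
    using W openin_subset topspace_gtop by blast
  then obtain N where N: "openin (gtop G) N" "g \<in> N" "G_set G N"
    by (rule G_set_nhd)
  define V where "V = N \<inter> W"
  have V: "openin (gtop G) V" "g \<in> V" "V \<subseteq> W"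
    using N W by (auto simp: V_def)
  have inj: "inj_on (rng G) V" "inj_on (src G) V" "V \<subseteq> arrows G"
    using N(3) by (auto simp: G_set_def V_def intro: inj_on_subset)
  have rV: "openin (unit_space G) (rng G ` V)"
    using open_map_rng V(1) by (simp add: open_map_def)
  have unit: "compact_space (unit_space G)" "\<And>C. connectedin (unit_space G) C \<Longrightarrow> \<exists>x. C \<subseteq> {x}"
    using cantor by (auto simp: cantor_space_def)
  obtain A where A: "clopenin (unit_space G) A" "rng G g \<in> A" "A \<subseteq> rng G ` V"
    by (rule zero_dimensional_nhds[OF unit(1) Hausdorff_unit_space unit(2) rV imageI[OF V(2)]])
  define U where "U = {h \<in> V. rng G h \<in> A}"
  let ?X = "subtopology (gtop G) V" and ?Y = "subtopology (unit_space G) (rng G ` V)"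
  have top: "topspace ?X = V" "topspace ?Y = rng G ` V"
    using openin_subset[OF V(1)] openin_subset[OF rV] by auto
  have "homeomorphic_map ?X ?Y (rng G)"
  proof (rule bijective_open_imp_homeomorphic_map)
    show "continuous_map ?X ?Y (rng G)"
      using continuous_rng by (auto simp: continuous_map_in_subtopology continuous_map_from_subtopology)
    show "open_map ?X ?Y (rng G)"
      using open_map_rng V(1) rV by (auto simp: open_map_def openin_open_subtopology)
  qed (use top inj in auto)
  then obtain \<tau> where \<tau>: "homeomorphic_maps ?X ?Y (rng G) \<tau>"
    by (auto simp: homeomorphic_map_maps)
  have "compactin (unit_space G) A"
    using A(1) unit(1) closedin_compact_space by (auto simp: clopenin_def)
  then have "compactin ?Y A"
    using A(3) by (simp add: compactin_subtopology)
  then have "compactin ?X (\<tau> ` A)"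
    using \<tau> by (auto simp: homeomorphic_maps_def intro: image_compactin)
  moreover have "\<tau> ` A = U"
  proof -
    have "\<tau> (rng G h) = h" if "h \<in> U" for h
      using \<tau> that top by (auto simp: homeomorphic_maps_def U_def)
    then have "\<tau> ` rng G ` U = id ` U"
      unfolding image_image by (intro image_cong) simp_all
    moreover have "A = rng G ` U"
      using A(3) by (auto simp: U_def)
    ultimately show ?thesis
      by simp
  qed
  ultimately have "compactin (gtop G) U"
    by (simp add: compactin_subtopology)
  moreover have "openin (gtop G) U"
    unfolding U_def using A(1) V(1) openin_continuous_map_preimage_gen[OF continuous_rng]
    by (auto simp: clopenin_def)
  moreover have "G_set G U"
    using inj by (auto simp: G_set_def U_def intro: inj_on_subset)
  ultimately have "compact_open_G_set G U"
    by (simp add: compact_open_G_set_def)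
  moreover have "g \<in> U" "U \<subseteq> W"
    using V A by (auto simp: U_def)
  ultimately show ?thesis
    by (rule that)
qed

lemma sum_of_G_sets_zero: "sum_of_G_sets G 0"
  unfolding sum_of_G_sets_def by (intro exI[of _ "[]"]) (simp add: homologous_refl)

lemma sum_of_G_sets_add:
  assumes "sum_of_G_sets G f" "sum_of_G_sets G g"
  shows "sum_of_G_sets G (f + g)"
proof -
  obtain Us Vs where "\<forall>U\<in>set Us. compact_open_G_set G U" "homologous G f (sum_list (map indicator Us))"
    "\<forall>U\<in>set Vs. compact_open_G_set G U" "homologous G g (sum_list (map indicator Vs))"
    using assms by (auto simp: sum_of_G_sets_def)
  then show ?thesis
    unfolding sum_of_G_sets_def
    by (intro exI[of _ "Us @ Vs"]) (auto simp del: plus_fun_apply intro: homologous_add)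
qed

lemma sum_of_G_sets_sum:
  "(\<And>i. i \<in> I \<Longrightarrow> sum_of_G_sets G (f i)) \<Longrightarrow> sum_of_G_sets G (\<Sum>i\<in>I. f i)"
  by (induction I rule: infinite_finite_induct) (auto intro: sum_of_G_sets_zero sum_of_G_sets_add)

lemma sum_of_G_sets_homologous:
  "homologous G f (indicator U) \<Longrightarrow> compact_open_G_set G U \<Longrightarrow> sum_of_G_sets G f"
  unfolding sum_of_G_sets_def by (intro exI[of _ "[U]"]) simp

text \<open>For \<open>c \<ge> 0\<close> the set \<open>U\<close> is repeated; for negative
  \<open>c\<close> its inverse is, which represents \<open>- indicator U\<close>.\<close>

lemma sum_of_G_sets_scaled:
  assumes unit: "compact_space (unit_space G)" and U: "compact_open_G_set G U"
  shows "sum_of_G_sets G (\<lambda>g. c * indicator U g)"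
proof -
  have *: "sum_of_G_sets G (\<lambda>g. int n * f g)" if "sum_of_G_sets G f" for n f
  proof (induction n)
    case (Suc n)
    have "(\<lambda>g. int (Suc n) * f g) = f + (\<lambda>g. int n * f g)"
      by (simp add: fun_eq_iff algebra_simps)
    then show ?case
      using sum_of_G_sets_add[OF that Suc] by simp
  qed (use sum_of_G_sets_zero in \<open>simp add: zero_fun_def\<close>)
  show ?thesis
  proof (cases c rule: int_cases2)
    case (nonneg n)
    then show ?thesis
      using *[OF sum_of_G_sets_homologous[OF homologous_refl U]] by simp
  next
    case (nonpos n)
    have "sum_of_G_sets G (- indicator U)"
      using homologous_sym[OF homologous_inv[OF unit U]] compact_open_G_set_inv[OF U]
      by (rule sum_of_G_sets_homologous)
    then show ?thesis
      using *[of "- indicator U" n] nonpos by simp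
  qed
qed

lemma sum_of_G_sets_Cc:
  assumes cantor: "cantor_space (unit_space G)" and f: "f \<in> carrier (Cc (gtop G))"
  shows "sum_of_G_sets G f"
proof -
  have unit: "compact_space (unit_space G)"
    using cantor by (simp add: cantor_space_def)
  let ?K = "{g. f g \<noteq> 0}"
  have K: "compactin (gtop G) ?K" and cont: "continuous_map (gtop G) (discrete_topology UNIV) f"
    using f by (simp_all add: carrier_Cc_iff)
  \<comment> \<open>\<open>f\<close> is locally constant, so sets of this kind cover its
    support.\<close>
  define \<C> where "\<C> = {U. compact_open_G_set G U \<and> (\<exists>c. \<forall>g\<in>U. f g = c)}"
  have "?K \<subseteq> \<Union>\<C>"
  proof
    fix g assume "g \<in> ?K"
    then have g: "g \<in> topspace (gtop G)"
      using compactin_subset_topspace[OF K] by auto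
    have "openin (gtop G) {h \<in> topspace (gtop G). f h = f g}"
      using cont by (simp add: continuous_map_discrete_iff)
    then obtain U where "compact_open_G_set G U" "g \<in> U" "U \<subseteq> {h \<in> topspace (gtop G). f h = f g}"
      using compact_open_G_set_nhd[OF cantor, of _ g] g by blast
    then show "g \<in> \<Union>\<C>"
      by (auto simp: \<C>_def)
  qed
  moreover have "\<forall>U\<in>\<C>. openin (gtop G) U"
    using compact_open_G_setD(5) by (auto simp: \<C>_def)
  ultimately obtain \<F> where F: "finite \<F>" "\<F> \<subseteq> \<C>" "?K \<subseteq> \<Union>\<F>"
    using K unfolding compactin_def by (metis (no_types, lifting))
  obtain A :: "nat \<Rightarrow> 'a set" and n where A: "\<F> = A ` {i. i < n}"
    using finite_imp_nat_seg_image_inj_on[OF F(1)] by auto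
  \<comment> \<open>Each disjointed piece stays inside its \<open>A i\<close>, hence remains a
    \<open>G\<close>-set on which \<open>f\<close> is constant; it is clopen because only finitely
    many clopen sets are removed.\<close>
  let ?D = "disjointed A"
  have D: "compact_open_G_set G (?D i)" "\<exists>c. \<forall>g\<in>?D i. f g = c" if i: "i < n" for i
  proof -
    have Ai: "compact_open_G_set G (A k)" "\<exists>c. \<forall>g\<in>A k. f g = c" if "k \<le> i" for k
    proof -
      have "A k \<in> \<C>"
        using that i F(2) A by auto
      then show "compact_open_G_set G (A k)" "\<exists>c. \<forall>g\<in>A k. f g = c"
        by (auto simp: \<C>_def)
    qed
    show "\<exists>c. \<forall>g\<in>?D i. f g = c"
      using Ai(2)[OF order_refl] disjointed_subset[of A i] by (metis subsetD)
    have "openin (gtop G) (\<Union>k\<in>{0..<i}. A k)" "closedin (gtop G) (\<Union>k\<in>{0..<i}. A k)"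
      using Ai(1) compact_open_G_setD(6) by (auto intro!: closedin_Union simp: clopenin_def)
    then have "clopenin (gtop G) (?D i)"
      using compact_open_G_setD(6)[OF Ai(1)[OF order_refl]]
      by (auto simp: clopenin_def disjointed_def intro: openin_diff closedin_diff)
    then show "compact_open_G_set G (?D i)"
      using compact_open_G_set_subset[OF Ai(1)[OF order_refl] disjointed_subset[of A i]] by simp
  qed
  then obtain c where c: "\<And>i g. i < n \<Longrightarrow> g \<in> ?D i \<Longrightarrow> f g = c i"
    by metis
  have "f = (\<Sum>i<n. (\<lambda>g. c i * indicator (?D i) g))"
  proof
    fix g
    have "disjoint_family_on ?D {..<n}"
      using disjoint_family_disjointed[of A] by (rule disjoint_family_on_mono[rotated]) simp
    then have "(\<Sum>i<n. indicator (?D i) g) = (indicator (\<Union>i<n. ?D i) g :: int)"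
      by (simp add: indicator_UN_disjoint)
    moreover have "(\<Union>i<n. ?D i) = \<Union>\<F>"
      using finite_UN_disjointed_eq[of A n] A by (simp add: atLeast0LessThan lessThan_def)
    \<comment> \<open>Inside the union exactly one indicator is 1, and outside it \<open>f\<close>
      vanishes.\<close>
    ultimately have "f g = (\<Sum>i<n. f g * indicator (?D i) g)"
      using F(3) by (auto simp: indicator_def simp flip: sum_distrib_left)
    also have "\<dots> = (\<Sum>i<n. c i * indicator (?D i) g)"
      using c by (intro sum.cong) (auto simp: indicator_def)
    finally show "f g = (\<Sum>i<n. (\<lambda>g. c i * indicator (?D i) g)) g"
      by (simp add: sum_fun_apply)
  qed
  moreover have "sum_of_G_sets G (\<Sum>i<n. (\<lambda>g. c i * indicator (?D i) g))"
    by (intro sum_of_G_sets_sum sum_of_G_sets_scaled unit D) simp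
  ultimately show ?thesis
    by simp
qed

lemma cycle_homologous_full_G_set:
  assumes cantor: "cantor_space (unit_space G)" and inf: "properly_infinite G (gunits G)"
    and f: "f \<in> carrier (Cc (gtop G))" "\<delta>1 G f = 0"
  obtains T where "compact_open_G_set G T" "src G ` T = gunits G" "rng G ` T = gunits G"
    "homologous G (indicator T) f"
proof -
  have unit: "compact_space (unit_space G)"
    using cantor by (simp add: cantor_space_def)
  obtain Us where Us: "\<forall>U\<in>set Us. compact_open_G_set G U" "homologous G f (sum_list (map indicator Us))"
    using sum_of_G_sets_Cc[OF cantor f(1)] by (auto simp: sum_of_G_sets_def)
  define n where "n = length Us"
  define U where "U i = Us ! i" for i
  have U: "compact_open_G_set G (U i)" if "i < n" for i
    using that Us(1) by (simp add: U_def n_def)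
  let ?S = "\<Sum>i<n. indicator (U i) :: 'a \<Rightarrow> int"
  have S: "sum_list (map indicator Us) = ?S"
    by (simp add: sum_list_sum_nth n_def U_def lessThan_atLeast0)
  have SC: "?S \<in> carrier (Cc (gtop G))"
    using U by (intro Cc_sum Cc_indicator_G_set) simp
  \<comment> \<open>\<open>\<delta>1\<close> is constant on homology classes, so the sum inherits
    the cycle condition. Evaluated at \<open>x\<close>, it says that \<open>x\<close> lies in as
    many sources as ranges.\<close>
  have "0 = \<delta>1 G ?S"
    using \<delta>1_homologous[OF f(1) SC] Us(2) f(2) S by simp
  also have "\<dots> = (\<Sum>i<n. indicator (src G ` U i) - indicator (rng G ` U i))"
    using U by (subst \<delta>1_sum) (auto intro!: Cc_indicator_G_set sum.cong simp: \<delta>1_indicator)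
  finally have "0 = (\<Sum>i<n. indicator (src G ` U i) x - indicator (rng G ` U i) x :: int)" for x
    by (metis (mono_tags, lifting) minus_apply sum.cong sum_fun_apply zero_fun_apply)
  then have "(\<Sum>i<n. indicator (src G ` U i) x :: int) = (\<Sum>i<n. indicator (rng G ` U i) x)" for x
    by (simp add: sum_subtractf)
  moreover have "int (hits A n x) = (\<Sum>i<n. indicator (A i) x)" for A :: "nat \<Rightarrow> 'a set" and x
    by (simp add: hits_def indicator_def)
  ultimately have "int (hits (\<lambda>i. src G ` U i) n x) = int (hits (\<lambda>i. rng G ` U i) n x)" for x
    by (simp only:)
  then have "hits (\<lambda>i. src G ` U i) n x = hits (\<lambda>i. rng G ` U i) n x" for x
    by (simp only: of_nat_eq_iff)
  from full_G_set_of_cycle[OF unit inf U this]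
  obtain T where T: "compact_open_G_set G T" "src G ` T = gunits G" "rng G ` T = gunits G"
    "homologous G (indicator T) ?S"
    by blast
  have "homologous G (indicator T) f"
    using homologous_trans[OF T(4)] homologous_sym[OF Us(2)] S by simp
  then show ?thesis
    using that T by blast
qed

section \<open>Full G-sets and their homeomorphisms\<close>

lemma G_set_map_apply:
  assumes "inj_on (src G) U" "g \<in> U"
  shows "G_set_map G U (src G g) = rng G g"
  using assms by (simp add: G_set_map_def)

text \<open>
  The product of \<open>U\<close> with the inverse of \<open>V\<close> is an open set of isotropy, hence consists of units.
\<close>

lemma G_set_map_eq_imp_subset:
  assumes ep: "essentially_principal G"
    and U: "compact_open_G_set G U" and V: "compact_open_G_set G V"
    and src: "src G ` U = src G ` V" and eq: "G_set_map G U = G_set_map G V"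
  shows "U \<subseteq> V"
proof -
  note UD = compact_open_G_setD[OF U] and VD = compact_open_G_setD[OF V]
  have same: "rng G g = rng G h" if "g \<in> U" "h \<in> V" "src G g = src G h" for g h
    using G_set_map_apply[OF UD(3) that(1)] G_set_map_apply[OF VD(3) that(2)] eq that(3) by simp
  let ?P = "gprod G U (ginv G ` V)"
  have "?P \<subseteq> {k \<in> arrows G. rng G k = src G k}"
    using VD(1) same by (auto simp: gprod_def mult_closed rng_mult src_mult)
      (metis composable_iff rng_inv src_inv subsetD)
  then have "?P \<subseteq> gunits G"
    using interior_of_maximal openin_gprod[OF U openin_inv_image[OF VD(5)]] ep
    unfolding essentially_principal_def by metis
  moreover have "\<exists>h\<in>V. src G g = src G h" if "g \<in> U" for g
    using that src by (metis imageE imageI)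
  ultimately show "U \<subseteq> V"
  proof (intro subsetI)
    fix g assume P: "?P \<subseteq> gunits G" and ex: "\<And>g. g \<in> U \<Longrightarrow> \<exists>h\<in>V. src G g = src G h" and g: "g \<in> U"
    obtain h where h: "h \<in> V" "src G g = src G h"
      using ex[OF g] by blast
    have arr: "g \<in> arrows G" "h \<in> arrows G"
      using g h UD(1) VD(1) by auto
    then have "gmult G g (ginv G h) \<in> ?P"
      using g h unfolding gprod_def
      by (intro image_eqI[of _ _ "(g, ginv G h)"]) (auto simp: composable_iff structure_simps)
    then have "gmult G g (ginv G h) \<in> gunits G"
      using P by blast
    then have "g = h"
      by (rule mult_inv_unit_imp_eq[OF arr h(2)])
    then show "g \<in> V"
      using h by simp
  qed
qed

lemma full_G_set_for_unique:
  assumes "essentially_principal G" "full_G_set_for G \<alpha> U" "full_G_set_for G \<alpha> V"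
  shows "U = V"
proof -
  have U: "compact_open_G_set G U" "src G ` U = gunits G" "G_set_map G U = \<alpha>"
    and V: "compact_open_G_set G V" "src G ` V = gunits G" "G_set_map G V = \<alpha>"
    using assms(2,3) by (simp_all add: full_G_set_for_def)
  have "U \<subseteq> V"
    by (rule G_set_map_eq_imp_subset[OF assms(1) U(1) V(1)]) (simp_all only: U(2,3) V(2,3))
  moreover have "V \<subseteq> U"
    by (rule G_set_map_eq_imp_subset[OF assms(1) V(1) U(1)]) (simp_all only: U(2,3) V(2,3))
  ultimately show ?thesis
    by blast
qed

text \<open>The map is \<open>rng\<close> after the inverse of \<open>src\<close> on
  \<open>U\<close>, and both restrict to homeomorphisms of \<open>U\<close> onto the unit
  space.\<close>

lemma homeomorphic_map_G_set_map:
  assumes U: "compact_open_G_set G U" and "src G ` U = gunits G" "rng G ` U = gunits G"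
  shows "homeomorphic_map (unit_space G) (unit_space G) (G_set_map G U)"
proof -
  note UD = compact_open_G_setD[OF U]
  let ?X = "subtopology (gtop G) U"
  have unit: "subtopology (unit_space G) (gunits G) = unit_space G"
    by (simp add: unit_space_def subtopology_subtopology)
  have s: "homeomorphic_map ?X (unit_space G) (src G)" and r: "homeomorphic_map ?X (unit_space G) (rng G)"
    using homeomorphic_map_G_set[OF U continuous_src UD(3)] homeomorphic_map_G_set[OF U continuous_rng UD(2)]
    by (simp_all add: assms(2,3) unit)
  obtain \<tau> where \<tau>: "homeomorphic_maps ?X (unit_space G) (src G) \<tau>"
    using s by (auto simp: homeomorphic_map_maps)
  then have "homeomorphic_map (unit_space G) (unit_space G) (rng G \<circ> \<tau>)"
    using homeomorphic_map_compose[OF _ r] homeomorphic_maps_map by blast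
  moreover have "(rng G \<circ> \<tau>) x = G_set_map G U x" if x: "x \<in> topspace (unit_space G)" for x
  proof -
    obtain u where u: "u \<in> U" "x = src G u"
      using x assms(2) by (auto simp: topspace_unit_space)
    have "\<tau> (src G u) = u"
      using \<tau> u(1) UD(1) by (auto simp: homeomorphic_maps_def topspace_gtop)
    then show ?thesis
      using G_set_map_apply[OF UD(3) u(1)] u(2) by simp
  qed
  ultimately show ?thesis
    by (rule homeomorphic_map_eq)
qed

section \<open>Homology classes and the index map\<close>

lemma carrier_cycles1:
  "f \<in> carrier (cycles1 G) \<longleftrightarrow> f \<in> carrier (Cc (gtop G)) \<and> \<delta>1 G f = 0"
  by (simp add: cycles1_def kernel_def Cc_def zero_fun_def)

lemma carrier_H1: "carrier (H1 G) = homology_class1 G ` carrier (cycles1 G)"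
  by (auto simp: H1_def FactGroup_def RCOSETS_def homology_class1_def)

text \<open>Cosets are compared as sets of functions: \<open>b + f = (b + (f - g)) + g\<close>, and
  boundaries are closed under addition.\<close>

lemma homology_class1_eq:
  assumes "homologous G f g"
  shows "homology_class1 G f = homology_class1 G g"
proof -
  have coset: "homology_class1 G f = (\<lambda>b. b + f) ` boundaries1 G" for f
    by (auto simp: homology_class1_def r_coset_def cycles1_def Cc_def plus_fun_def)
  have *: "homology_class1 G f \<subseteq> homology_class1 G g" if fg: "homologous G f g" for f g
    unfolding coset
  proof
    fix x assume "x \<in> (\<lambda>b. b + f) ` boundaries1 G"
    then obtain b where b: "b \<in> boundaries1 G" "x = b + f"
      by auto
    then have "x = (b + (f - g)) + g"
      by simp
    moreover have "b + (f - g) \<in> boundaries1 G"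
      using boundaries1_add[OF b(1)] fg by (simp add: homologous_def)
    ultimately show "x \<in> (\<lambda>b. b + g) ` boundaries1 G"
      by blast
  qed
  show ?thesis
    using *[OF assms] *[OF homologous_sym[OF assms]] by blast
qed

lemma index_map_eq:
  assumes "essentially_principal G" "full_G_set_for G \<alpha> U"
  shows "index_map G \<alpha> = homology_class1 G (indicator U)"
proof -
  have "(THE U. full_G_set_for G \<alpha> U) = U"
    by (rule the_equality, rule assms(2)) (erule full_G_set_for_unique[OF assms(1) _ assms(2)])
  then show ?thesis
    by (simp add: index_map_def)
qed

lemma carrier_full_group:
  "\<alpha> \<in> carrier (full_group G) \<longleftrightarrow> (\<exists>U. full_G_set_for G \<alpha> U)"
proof
  assume "\<exists>U. full_G_set_for G \<alpha> U"
  moreover from this obtain U where U: "compact_open_G_set G U" "src G ` U = gunits G" "rng G ` U = gunits G"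
    "\<alpha> = G_set_map G U"
    by (auto simp: full_G_set_for_def)
  moreover have "\<alpha> \<in> extensional (gunits G)"
    unfolding U(4) G_set_map_def U(2) by (rule restrict_extensional)
  ultimately show "\<alpha> \<in> carrier (full_group G)"
    using homeomorphic_map_G_set_map[OF U(1-3)] by (simp add: full_group_def)
qed (simp add: full_group_def)

end

theorem theorem5p2:
  fixes G :: "('g, 'm) groupoid_scheme"
  assumes "etale_groupoid G"
    and "essentially_principal G"
    and "cantor_space (unit_space G)"
    and "purely_infinite G"
  shows "index_map G ` carrier (full_group G) = carrier (H1 G)"
proof -
  interpret etale_groupoid G
    by (rule assms(1))
  have "clopenin (unit_space G) (gunits G)"
    using topspace_unit_space unfolding clopenin_def by (metis openin_topspace closedin_topspace)
  then have inf: "properly_infinite G (gunits G)"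
    using assms(4) by (simp add: purely_infinite_def)
  show ?thesis
  proof (intro equalityI subsetI)
    fix x assume "x \<in> index_map G ` carrier (full_group G)"
    then obtain \<alpha> U where U: "full_G_set_for G \<alpha> U" and x: "x = homology_class1 G (indicator U)"
      using index_map_eq[OF assms(2)] carrier_full_group by auto
    \<comment> \<open>Source and range of \<open>U\<close> are both the whole unit space, so
      \<open>\<delta>1\<close> vanishes. This inclusion says that the index map takes values in
      \<open>H1 G\<close>; the other one is surjectivity.\<close>
    have "indicator U \<in> carrier (cycles1 G)"
      using U by (simp add: carrier_cycles1 full_G_set_for_def Cc_indicator_G_set \<delta>1_indicator)
    then show "x \<in> carrier (H1 G)"
      unfolding carrier_H1 x by (rule imageI)
  next
    fix x assume "x \<in> carrier (H1 G)"
    then obtain f where f: "f \<in> carrier (Cc (gtop G))" "\<delta>1 G f = 0" and x: "x = homology_class1 G f"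
      using carrier_H1 carrier_cycles1 by auto
    obtain T where T: "compact_open_G_set G T" "src G ` T = gunits G" "rng G ` T = gunits G"
      "homologous G (indicator T) f"
      using cycle_homologous_full_G_set[OF assms(3) inf f] by blast
    then have full: "full_G_set_for G (G_set_map G T) T"
      by (simp add: full_G_set_for_def)
    then have "x = index_map G (G_set_map G T)"
      using index_map_eq[OF assms(2) full] homology_class1_eq[OF T(4)] x by simp
    then show "x \<in> index_map G ` carrier (full_group G)"
      using carrier_full_group full by blast
  qed
qed

end
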